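(* Let $d\ge1$, $\mu>-\frac12$ and $\beta>-d$. For $\mathbf b\in\mathbb{B}^d$, $r>0$ and $r<1$, the generating function for $\mathsf{U}^{\mathsf L}_{\mathbf k,n}$ is given by $$\sum_{n=0}^\infty\ \sum_{|\mathbf k|\le n}\frac{(-1)^{|\mathbf k|}(2\mu)_{|\mathbf k|}}{2^{|\mathbf k|}(\mu+\frac12)_{|\mathbf k|}\,\mathbf k!\,(n-|\mathbf k|)!}\,\mathsf{U}^{\mathsf L}_{\mathbf k,n}(x,t)\,\mathbf b^{\mathbf k}r^n=\frac{(1-r)^{2\mu}\,e^{-\frac{tr}{1-r}}}{(1-r)^{\beta+d}\Bigl(\bigl[(1-r)^2-r\langle\mathbf b,x\rangle\bigr]^2+r^2\|\mathbf b\|^2(t^2-\|x\|^2)\Bigr)^{\mu}}.$$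
   Context: $\mathbb{B}^d=\{x\in\mathbb{R}^d:\|x\|\le1\}$ is the unit ball of $\mathbb{R}^d$; $(x,t)$ is a point of the cone $\mathbb{V}^{d+1}=\{(x,t):\|x\|\le t,\ x\in\mathbb{R}^d,\ 0\le t<\infty\}$; $W_{\beta,\mu}(x,t)=(t^2-\|x\|^2)^{\mu-\frac12}t^\beta e^{-t}$. For $\mathbf k\in\mathbb{N}_0^d$: $|\mathbf k|=k_1+\cdots+k_d$, $\mathbf k!=k_1!\cdots k_d!$, $\mathbf b^{\mathbf k}=b_1^{k_1}\cdots b_d^{k_d}$; $(a)_k=a(a+1)\cdots(a+k-1)$. The inner sum runs over $\mathbf k\in\mathbb{N}_0^d$ with $|\mathbf k|\le n$. For $|\mathbf k|=k\le n$, $$\mathsf{U}^{\mathsf L}_{\mathbf k,n}(x,t)=\frac{1}{W_{\beta,\mu}(x,t)}\,\frac{1}{t^{2k+2\mu+d-1}}\left[\frac{\partial^{\mathbf k}}{\partial x^{\mathbf k}}(t^2-\|x\|^2)^{k+\mu-\frac12}\right]\left[\frac{\partial^{n-k}}{\partial t^{n-k}}\bigl(t^{n+k+\beta+2\mu+d-1}e^{-t}\bigr)\right],$$ which is a polynomial in $(x,t)$.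
   Formalization: The series need not converge for all 0<r<1 (d=b=x=t=μ=1, r=1/2); the formula is proved for each such r at which it converges, and convergence is proved if μ=0 or [(1-z)²-z⟨b,x⟩]²+z²‖b‖²(t²-‖x‖²) has no complex zero with |z|≤r. *)

theory Defs
  imports "HOL-Analysis.Analysis"
begin

definition solid_cone :: "((real ^ 'd) \<times> real) set" where
  "solid_cone = {(x, t). norm x \<le> t}"

definition cone_weight :: "real \<Rightarrow> real \<Rightarrow> (real ^ 'd) \<times> real \<Rightarrow> real" where
  "cone_weight \<beta> \<mu> = (\<lambda>(x, t). (t^2 - (norm x)^2) powr (\<mu> - 1/2) * t powr \<beta> * exp (- t))"

definition mdeg :: "('d::finite \<Rightarrow> nat) \<Rightarrow> nat" where
  "mdeg k = (\<Sum>i\<in>UNIV. k i)"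

definition mfact :: "('d::finite \<Rightarrow> nat) \<Rightarrow> real" where
  "mfact k = (\<Prod>i\<in>UNIV. fact (k i))"

definition mpow :: "real ^ 'd \<Rightarrow> ('d::finite \<Rightarrow> nat) \<Rightarrow> real" where
  "mpow b k = (\<Prod>i\<in>UNIV. (b $ i) ^ k i)"

definition partial_deriv :: "'d::finite \<Rightarrow> (real ^ 'd \<Rightarrow> real) \<Rightarrow> real ^ 'd \<Rightarrow> real" where
  "partial_deriv i f x = deriv (\<lambda>s. f (x + s *\<^sub>R axis i 1)) 0"

text \<open>The index type carries no order, so the coordinates are listed in an arbitrary fixed order;
  on smooth functions, the only ones differentiated below, the order is immaterial.\<close>

definition coords :: "'d::finite list" where
  "coords = (SOME is. distinct is \<and> set is = UNIV)"

definition mixed_deriv :: "('d::finite \<Rightarrow> nat) \<Rightarrow> (real ^ 'd \<Rightarrow> real) \<Rightarrow> real ^ 'd \<Rightarrow> real" where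
  "mixed_deriv k f = foldr (\<lambda>i. partial_deriv i ^^ k i) coords f"

text \<open>The Rodrigues-type formula. It makes literal sense only for \<open>norm x < t\<close>, where all bases of
  real powers are positive, and for \<open>mdeg k \<le> n\<close>.\<close>

definition UL_rodrigues ::
    "real \<Rightarrow> real \<Rightarrow> ('d::finite \<Rightarrow> nat) \<Rightarrow> nat \<Rightarrow> (real ^ 'd) \<times> real \<Rightarrow> real" where
  "UL_rodrigues \<beta> \<mu> k n = (\<lambda>(x, t).
     1 / cone_weight \<beta> \<mu> (x, t)
     * (1 / t powr (2 * real (mdeg k) + 2 * \<mu> + real CARD('d) - 1))
     * mixed_deriv k (\<lambda>y. (t^2 - (norm y)^2) powr (real (mdeg k) + \<mu> - 1/2)) x
     * (deriv ^^ (n - mdeg k))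
         (\<lambda>s. s powr (real n + real (mdeg k) + \<beta> + 2 * \<mu> + real CARD('d) - 1) * exp (- s)) t)"

text \<open>The polynomial in \<open>(x, t)\<close> given by that formula in the interior of the cone; it also provides
  the values on the boundary \<open>norm x = t\<close>. It is unique because the interior is open and
  nonempty.\<close>

definition UL :: "real \<Rightarrow> real \<Rightarrow> ('d::finite \<Rightarrow> nat) \<Rightarrow> nat \<Rightarrow> (real ^ 'd) \<times> real \<Rightarrow> real" where
  "UL \<beta> \<mu> k n = (THE P. real_polynomial_function P \<and>
     (\<forall>x t. norm x < t \<longrightarrow> P (x, t) = UL_rodrigues \<beta> \<mu> k n (x, t)))"

definition UL_gf_term ::
    "real \<Rightarrow> real \<Rightarrow> real ^ 'd \<Rightarrow> real ^ 'd \<Rightarrow> real \<Rightarrow> real \<Rightarrow> nat \<Rightarrow> real" where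
  "UL_gf_term \<beta> \<mu> b x t r n = (\<Sum>k\<in>{k :: 'd::finite \<Rightarrow> nat. mdeg k \<le> n}.
     ((-1) ^ mdeg k * pochhammer (2 * \<mu>) (mdeg k))
     / (2 ^ mdeg k * pochhammer (\<mu> + 1/2) (mdeg k) * mfact k * fact (n - mdeg k))
     * UL \<beta> \<mu> k n (x, t) * mpow b k * r ^ n)"

text \<open>Real powers with \<open>a\<^sup>0 = 1\<close> also for \<open>a = 0\<close>, where \<open>0 powr 0 = 0\<close>. Needed for exponent \<open>\<mu> = 0\<close>,
  since the base in the generating function can vanish on the boundary of the cone.\<close>

definition rpow :: "real \<Rightarrow> real \<Rightarrow> real" where
  "rpow a p = (if p = 0 then 1 else a powr p)"

end

theory Submission
  imports Defs "HOL-Complex_Analysis.Complex_Analysis"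
begin

text \<open>In the interior of the cone the derivatives in the Rodrigues formula can be written out: the
  one in \<open>t\<close> gives a Laguerre polynomial, and the mixed one in \<open>x\<close> an explicit sum over the
  splittings \<open>k = l + 2 j\<close> of the multi-index. Hence \<open>UL\<close> is an explicit polynomial on the whole
  cone. By the multinomial theorem the sum over all \<open>k\<close> with \<open>mdeg k = m\<close> collapses to a
  Gegenbauer-type polynomial in \<open>b \<bullet> x\<close> and \<open>(norm b)\<^sup>2 (t\<^sup>2 - (norm x)\<^sup>2)\<close>, with generating function
  \<open>((1 - c w)\<^sup>2 + e w\<^sup>2) powr - \<mu>\<close>. Multiplying with the Laguerre generating function and substituting
  \<open>w = r / (1 - r)\<^sup>2\<close> gives the claim for small \<open>r\<close>.

  Where the quartic in the denominator has no zero in a disc, it has a holomorphic logarithm there, so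
  the series converges. Conversely, if the series converges at \<open>r\<close>, the identity theorem gives the
  formula on the real segment up to the first zero of the quartic, and Abel's limit theorem at \<open>r\<close>.
  A zero before \<open>r\<close> is impossible for \<open>\<mu> \<noteq> 0\<close>: for \<open>\<mu> > 0\<close> the right-hand side is unbounded, and
  for \<open>- 1/2 < \<mu> < 0\<close> it behaves like \<open>(r\<^sub>0 - r) powr (- 2 \<mu>)\<close> and is not differentiable there.\<close>

section \<open>Mixed derivatives of powers of the cone quadratic\<close>

definition falling_factorial :: "real \<Rightarrow> nat \<Rightarrow> real" where
  "falling_factorial p N = (\<Prod>i<N. p - real i)"

lemma falling_factorial_Suc [simp]: "falling_factorial p (Suc N) = falling_factorial p N * (p - real N)"
  by (simp add: falling_factorial_def)

lemma falling_factorial_0 [simp]: "falling_factorial p 0 = 1"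
  by (simp add: falling_factorial_def)

lemma mdeg_remove: "mdeg k = k i + (\<Sum>m\<in>UNIV - {i}. k m)"
  unfolding mdeg_def by (rule sum.remove) auto

lemma mdeg_upd: "mdeg (k(i := v)) + k i = mdeg k + v"
  unfolding mdeg_remove[of _ i] by simp

lemma finite_mdeg_eq: "finite {k :: 'd::finite \<Rightarrow> nat. mdeg k = n}"
proof (rule finite_subset)
  show "{k :: 'd \<Rightarrow> nat. mdeg k = n} \<subseteq> PiE UNIV (\<lambda>_. {..n})"
    unfolding mdeg_def PiE_def Pi_def extensional_def
    by auto (metis UNIV_I finite_class.finite_UNIV member_le_sum zero_le)
qed (simp add: finite_PiE)

text \<open>One summand of \<open>\<partial>\<^sup>k (t\<^sup>2 - (norm y)\<^sup>2) powr p / k!\<close>, where \<open>k = l + 2 j\<close>: \<open>l i\<close> counts the factors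
  \<open>- 2 y i\<close> and \<open>j i\<close> those differentiated once more.\<close>

definition rodrigues_term :: "real \<Rightarrow> real \<Rightarrow> ('d::finite \<Rightarrow> nat) \<Rightarrow> ('d \<Rightarrow> nat) \<Rightarrow> real ^ 'd \<Rightarrow> real" where
  "rodrigues_term t p l j y = (\<Prod>i\<in>UNIV. (- 2 * y $ i) ^ l i / fact (l i) * ((- 1) ^ j i / fact (j i)))
     * falling_factorial p (mdeg l + mdeg j) * (t^2 - (norm y)^2) powr (p - real (mdeg l + mdeg j))"

text \<open>With \<open>q = t^2 - (norm y)^2\<close>, the binomial series of
  \<open>(q + u) powr p\<close> is expanded in \<open>h\<close>, where \<open>u\<close> is the sum
  of the terms \<open>- 2 * y $ i * h $ i\<close> and \<open>- (h $ i)^2\<close>. These pairs are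
  exactly the ways to reach the monomial in \<open>h\<close> with exponents \<open>k\<close>:
  \<open>l i\<close> linear and \<open>j i\<close> quadratic factors in each coordinate.\<close>

definition half_splits :: "('d \<Rightarrow> nat) \<Rightarrow> (('d \<Rightarrow> nat) \<times> ('d \<Rightarrow> nat)) set" where
  "half_splits k = {(l, j). \<forall>i. l i + 2 * j i = k i}"

lemma half_splits_iff:
  "(l, j) \<in> half_splits k \<longleftrightarrow> l i + 2 * j i = k i \<and> (\<forall>m. m \<noteq> i \<longrightarrow> l m + 2 * j m = k m)"
  unfolding half_splits_def by auto

lemma half_splits_upd_iff:
  "(l, j) \<in> half_splits (k(i := c)) \<longleftrightarrow> l i + 2 * j i = c \<and> (\<forall>m. m \<noteq> i \<longrightarrow> l m + 2 * j m = k m)"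
  unfolding half_splits_def by auto

lemma finite_half_splits: "finite (half_splits (k :: 'd::finite \<Rightarrow> nat))"
proof (rule finite_subset)
  let ?P = "PiE UNIV (\<lambda>i. {..k i})"
  show "half_splits k \<subseteq> ?P \<times> ?P"
  proof
    fix p assume "p \<in> half_splits k"
    then obtain l j where p: "p = (l, j)" "\<And>i. l i + 2 * j i = k i"
      by (auto simp: half_splits_def)
    have "l i \<le> k i \<and> j i \<le> k i" for i
      using p(2)[of i] by linarith
    then show "p \<in> ?P \<times> ?P" using p(1) by (auto simp: PiE_def Pi_def)
  qed
qed (simp add: finite_PiE)

lemma norm_add_axis:
  "(norm (y + s *\<^sub>R axis i 1))^2 = (norm y)^2 + 2 * s * y $ i + s^2" for y :: "real ^ 'd"
proof -
  have "(norm (y + s *\<^sub>R axis i 1))^2 = (norm y)^2 + 2 * (y \<bullet> (s *\<^sub>R axis i 1)) + (norm (s *\<^sub>R (axis i 1 :: real ^ 'd)))^2"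
    by (simp only: power2_norm_eq_inner inner_add inner_commute)
  then show ?thesis by (simp add: inner_axis)
qed

text \<open>The product rule: differentiating the monomial turns a linear factor into a quadratic
  one and keeps \<open>mdeg l + mdeg j\<close>; differentiating the real power creates one more
  linear factor. The coefficients repair the factorials. The case distinction guards against
  truncated subtraction at \<open>l i = 0\<close>.\<close>

lemma rodrigues_term_deriv:
  fixes y :: "real ^ 'd"
  assumes "norm y < t"
  shows "((\<lambda>s. rodrigues_term t p l j (y + s *\<^sub>R axis i 1)) has_real_derivative
     (if 0 < l i then 2 * real (j i + 1) * rodrigues_term t p (l(i := l i - 1)) (j(i := j i + 1)) y else 0)
     + real (l i + 1) * rodrigues_term t p (l(i := l i + 1)) j y) (at 0)"
proof -
  define C where "C = (\<Prod>m\<in>UNIV - {i}. (- 2 * y $ m) ^ l m / fact (l m) * ((- 1) ^ j m / fact (j m)))"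
  define N where "N = mdeg l + mdeg j"
  define q where "q = t^2 - (norm y)^2"
  define v where "v = - 2 * y $ i"
  have q0: "q > 0"
    unfolding q_def using assms by (simp add: power_strict_mono)
  have rem: "(\<Prod>m\<in>UNIV. f m) = f i * (\<Prod>m\<in>UNIV - {i}. f m)" for f :: "'d \<Rightarrow> real"
    by (rule prod.remove) auto
  \<comment> \<open>Along the \<open>i\<close>-th axis only the factor with index \<open>i\<close>
    and the quadratic vary; the other factors form the constant \<open>C\<close>.\<close>
  have eq: "rodrigues_term t p l j (y + s *\<^sub>R axis i 1) =
      (v - 2 * s) ^ l i / fact (l i) * ((- 1) ^ j i / fact (j i)) * C * falling_factorial p N
      * (q + v * s - s^2) powr (p - real N)" for s
  proof -
    have "(\<Prod>m\<in>UNIV - {i}. (- 2 * (y + s *\<^sub>R axis i 1) $ m) ^ l m / fact (l m) * ((- 1) ^ j m / fact (j m))) = C"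
      unfolding C_def by (rule prod.cong) (auto simp: axis_def)
    moreover have "- 2 * (y + s *\<^sub>R axis i 1) $ i = v - 2 * s"
      by (simp add: v_def)
    moreover have "t^2 - (norm (y + s *\<^sub>R axis i 1))^2 = q + v * s - s^2"
      by (simp add: norm_add_axis q_def v_def)
    ultimately show ?thesis
      unfolding rodrigues_term_def by (subst rem) (simp only: N_def)
  qed
  have up: "rodrigues_term t p (l(i := l i + 1)) j y =
      v ^ (l i + 1) / fact (l i + 1) * ((- 1) ^ j i / fact (j i)) * C * (falling_factorial p N * (p - real N))
      * q powr (p - real N - 1)"
  proof -
    have "mdeg (l(i := l i + 1)) + mdeg j = Suc N"
      using mdeg_upd[of l i "l i + 1"] by (simp add: N_def)
    moreover have "(\<Prod>m\<in>UNIV - {i}. (- 2 * y $ m) ^ (l(i := l i + 1)) m / fact ((l(i := l i + 1)) m) * ((- 1) ^ j m / fact (j m))) = C"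
      unfolding C_def by (rule prod.cong) auto
    moreover have "p - real (Suc N) = p - real N - 1" by simp
    ultimately show ?thesis
      unfolding rodrigues_term_def by (subst rem) (simp only: falling_factorial_Suc fun_upd_same q_def[symmetric] v_def[symmetric])
  qed
  have dn: "rodrigues_term t p (l(i := l i - 1)) (j(i := j i + 1)) y =
      v ^ (l i - 1) / fact (l i - 1) * ((- 1) ^ (j i + 1) / fact (j i + 1)) * C * falling_factorial p N
      * q powr (p - real N)" if "l i > 0"
  proof -
    have "mdeg (l(i := l i - 1)) + mdeg (j(i := j i + 1)) = N"
      using that mdeg_upd[of l i "l i - 1"] mdeg_upd[of j i "j i + 1"] by (simp add: N_def)
    moreover have "(\<Prod>m\<in>UNIV - {i}. (- 2 * y $ m) ^ (l(i := l i - 1)) m / fact ((l(i := l i - 1)) m) * ((- 1) ^ (j(i := j i + 1)) m / fact ((j(i := j i + 1)) m))) = C"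
      unfolding C_def by (rule prod.cong) auto
    ultimately show ?thesis
      unfolding rodrigues_term_def by (subst rem) (simp only: fun_upd_same q_def[symmetric] v_def[symmetric])
  qed
  define K where "K = (- 1) ^ j i / fact (j i) * C * falling_factorial p N"
  have "((\<lambda>s. (v - 2 * s) ^ l i * (q + v * s - s^2) powr (p - real N)) has_real_derivative
      (real (l i) * v ^ (l i - 1) * (- 2)) * q powr (p - real N)
      + v ^ l i * ((p - real N) * q powr (p - real N - 1) * v)) (at 0)"
    using q0 by (auto intro!: derivative_eq_intros simp: algebra_simps)
  from DERIV_cmult[OF this, of "K / fact (l i)"]
  have D: "((\<lambda>s. rodrigues_term t p l j (y + s *\<^sub>R axis i 1)) has_real_derivative
      K / fact (l i) * ((real (l i) * v ^ (l i - 1) * (- 2)) * q powr (p - real N)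
      + v ^ l i * ((p - real N) * q powr (p - real N - 1) * v))) (at 0)"
    unfolding eq K_def by (simp add: field_simps)
  have A1: "K / fact (l i) * (v ^ l i * ((p - real N) * q powr (p - real N - 1) * v))
      = real (l i + 1) * rodrigues_term t p (l(i := l i + 1)) j y"
  proof -
    define m where "m = real (l i + 1)"
    have "m \<noteq> 0" and "fact (l i + 1) = m * (fact (l i) :: real)"
      by (simp_all add: m_def)
    then show ?thesis unfolding up K_def m_def[symmetric] by (simp add: mult_ac)
  qed
  have A2: "K / fact (l i) * ((real (l i) * v ^ (l i - 1) * (- 2)) * q powr (p - real N))
      = (if 0 < l i then 2 * real (j i + 1) * rodrigues_term t p (l(i := l i - 1)) (j(i := j i + 1)) y else 0)"
  proof (cases "l i")
    case (Suc l')
    have "2 * real (j i + 1) * rodrigues_term t p (l(i := l i - 1)) (j(i := j i + 1)) y = 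
       2 * real (j i + 1) * (v ^ l' / fact l' * ((- 1) ^ (j i + 1) / fact (j i + 1)) * C * falling_factorial p N
      * q powr (p - real N))" using dn Suc by simp
    also have "\<dots> = K / fact (l i) * ((real (l i) * v ^ (l i - 1) * (- 2)) * q powr (p - real N))"
      unfolding Suc K_def by (simp add: divide_simps del: of_nat_Suc)
    finally show ?thesis using Suc by simp
  qed simp
  show ?thesis
    using D unfolding distrib_left A1 A2 .
qed

text \<open>A factorial times the Taylor coefficient described at \<open>half_splits\<close>, hence
  the candidate for the mixed derivative of order \<open>k\<close>. It is confirmed one partial
  derivative at a time.\<close>

definition powr_mixed_deriv :: "real \<Rightarrow> real \<Rightarrow> ('d::finite \<Rightarrow> nat) \<Rightarrow> real ^ 'd \<Rightarrow> real" where
  "powr_mixed_deriv t p k y = mfact k * (\<Sum>(l, j)\<in>half_splits k. rodrigues_term t p l j y)"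

lemma mfact_upd_Suc: "mfact (k(i := k i + 1)) = real (k i + 1) * mfact k"
proof -
  have "mfact k = fact (k i) * (\<Prod>m\<in>UNIV - {i}. fact (k m))" for k :: "'a \<Rightarrow> nat"
    unfolding mfact_def by (rule prod.remove) auto
  note this[of k] this[of "k(i := k i + 1)"]
  moreover have "(\<Prod>m\<in>UNIV - {i}. fact ((k(i := k i + 1)) m) :: real) = (\<Prod>m\<in>UNIV - {i}. fact (k m))"
    by (rule prod.cong) auto
  ultimately show ?thesis by simp
qed

text \<open>Once both sums from the product rule run over the splittings of the raised index, the
  term of \<open>(l, j)\<close> has the coefficient \<open>2 * j i + l i = k i + 1\<close>, the
  quotient of the two values of \<open>mfact\<close>.\<close>

lemma partial_deriv_powr_mixed_deriv:
  fixes y :: "real ^ 'd"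
  assumes "norm y < t"
  shows "partial_deriv i (powr_mixed_deriv t p k) y = powr_mixed_deriv t p (k(i := k i + 1)) y"
proof -
  let ?k = "k(i := k i + 1)"
  have *: "((\<lambda>s. powr_mixed_deriv t p k (y + s *\<^sub>R axis i 1)) has_real_derivative
     mfact k * (\<Sum>(l, j)\<in>half_splits k.
     (if 0 < l i then 2 * real (j i + 1) * rodrigues_term t p (l(i := l i - 1)) (j(i := j i + 1)) y else 0)
     + real (l i + 1) * rodrigues_term t p (l(i := l i + 1)) j y)) (at 0)"
    unfolding powr_mixed_deriv_def case_prod_unfold
    by (intro DERIV_cmult DERIV_sum rodrigues_term_deriv assms)
  \<comment> \<open>Trading a linear for a quadratic factor is a bijection onto the splittings with
    \<open>j i > 0\<close>; those with \<open>j i = 0\<close> carry the coefficient 0.\<close>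
  have S1: "(\<Sum>(l, j)\<in>half_splits k.
     (if 0 < l i then 2 * real (j i + 1) * rodrigues_term t p (l(i := l i - 1)) (j(i := j i + 1)) y else 0))
     = (\<Sum>(l, j)\<in>half_splits ?k. 2 * real (j i) * rodrigues_term t p l j y)"
  proof -
    have "(\<Sum>(l, j)\<in>half_splits k.
     (if 0 < l i then 2 * real (j i + 1) * rodrigues_term t p (l(i := l i - 1)) (j(i := j i + 1)) y else 0))
      = (\<Sum>(l, j)\<in>half_splits k \<inter> {(l, j). 0 < l i}. 2 * real (j i + 1) * rodrigues_term t p (l(i := l i - 1)) (j(i := j i + 1)) y)"
      by (rule sum.mono_neutral_cong_right) (auto simp: finite_half_splits split: if_splits)
    also have "\<dots> = (\<Sum>(l, j)\<in>half_splits ?k \<inter> {(l, j). 0 < j i}. 2 * real (j i) * rodrigues_term t p l j y)"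
      by (rule sum.reindex_bij_witness[where i = "\<lambda>(l, j). (l(i := l i + 1), j(i := j i - 1))"
            and j = "\<lambda>(l, j). (l(i := l i - 1), j(i := j i + 1))"])
        (auto simp: half_splits_iff[of _ _ k i] half_splits_upd_iff fun_eq_iff)
    also have "\<dots> = (\<Sum>(l, j)\<in>half_splits ?k. 2 * real (j i) * rodrigues_term t p l j y)"
      by (rule sum.mono_neutral_left) (auto simp: finite_half_splits)
    finally show ?thesis .
  qed
  have S2: "(\<Sum>(l, j)\<in>half_splits k. real (l i + 1) * rodrigues_term t p (l(i := l i + 1)) j y)
     = (\<Sum>(l, j)\<in>half_splits ?k. real (l i) * rodrigues_term t p l j y)"
  proof -
    have "(\<Sum>(l, j)\<in>half_splits k. real (l i + 1) * rodrigues_term t p (l(i := l i + 1)) j y)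
       = (\<Sum>(l, j)\<in>half_splits ?k \<inter> {(l, j). 0 < l i}. real (l i) * rodrigues_term t p l j y)"
      by (rule sum.reindex_bij_witness[where i = "\<lambda>(l, j). (l(i := l i - 1), j)"
            and j = "\<lambda>(l, j). (l(i := l i + 1), j)"])
        (auto simp: half_splits_iff[of _ _ k i] half_splits_upd_iff fun_eq_iff)
    also have "\<dots> = (\<Sum>(l, j)\<in>half_splits ?k. real (l i) * rodrigues_term t p l j y)"
      by (rule sum.mono_neutral_left) (auto simp: finite_half_splits)
    finally show ?thesis .
  qed
  have "(\<Sum>(l, j)\<in>half_splits k.
     (if 0 < l i then 2 * real (j i + 1) * rodrigues_term t p (l(i := l i - 1)) (j(i := j i + 1)) y else 0)
     + real (l i + 1) * rodrigues_term t p (l(i := l i + 1)) j y)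
    = (\<Sum>(l, j)\<in>half_splits ?k. 2 * real (j i) * rodrigues_term t p l j y)
      + (\<Sum>(l, j)\<in>half_splits ?k. real (l i) * rodrigues_term t p l j y)"
    using S1 S2 by (simp add: case_prod_unfold sum.distrib)
  also have "\<dots> = (\<Sum>(l, j)\<in>half_splits ?k. real (k i + 1) * rodrigues_term t p l j y)"
    unfolding sum.distrib[symmetric]
  proof (rule sum.cong[OF refl], goal_cases)
    case (1 lj)
    obtain l j where lj: "lj = (l, j)" by (cases lj)
    with 1 have "(l, j) \<in> half_splits ?k" by simp
    then have "l i + 2 * j i = ?k i" unfolding half_splits_def by blast
    then have "l i + 2 * j i = k i + 1" by simp
    then have "real (l i) + 2 * real (j i) = real (k i + 1)"
      by (metis of_nat_add of_nat_mult of_nat_numeral)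
    then show ?case
      by (simp only: lj prod.case distrib_right[symmetric]) (simp add: add.commute)
  qed
  also have "\<dots> = real (k i + 1) * (\<Sum>(l, j)\<in>half_splits ?k. rodrigues_term t p l j y)"
    by (simp add: sum_distrib_left case_prod_unfold)
  finally have "((\<lambda>s. powr_mixed_deriv t p k (y + s *\<^sub>R axis i 1)) has_real_derivative
     powr_mixed_deriv t p ?k y) (at 0)"
    using * by (simp add: powr_mixed_deriv_def mfact_upd_Suc[of k i, simplified] mult_ac)
  then show ?thesis
    unfolding partial_deriv_def by (rule DERIV_imp_deriv)
qed

text \<open>The closed formula is available only on the open ball. Openness makes agreement there
  enough to iterate derivatives.\<close>

lemma partial_deriv_cong_ball:
  fixes y :: "real ^ 'd"
  assumes "\<And>y. norm y < t \<Longrightarrow> f y = g y" and "norm y < t"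
  shows "partial_deriv i f y = partial_deriv i g y"
  unfolding partial_deriv_def
proof (rule deriv_cong_ev)
  have "open {s :: real. norm (y + s *\<^sub>R axis i 1) < t}"
    by (intro open_Collect_less continuous_intros)
  then have "eventually (\<lambda>s. s \<in> {s :: real. norm (y + s *\<^sub>R axis i 1) < t}) (nhds 0)"
    by (rule eventually_nhds_in_open) (simp add: assms)
  then show "eventually (\<lambda>s. f (y + s *\<^sub>R axis i 1) = g (y + s *\<^sub>R axis i 1)) (nhds 0)"
    by eventually_elim (simp add: assms)
qed simp

lemma partial_deriv_funpow_powr_mixed_deriv:
  fixes f :: "real ^ 'd \<Rightarrow> real"
  assumes "\<And>y. norm y < t \<Longrightarrow> f y = powr_mixed_deriv t p k y" and "norm y < t"
  shows "(partial_deriv i ^^ n) f y = powr_mixed_deriv t p (k(i := k i + n)) y"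
  using assms(2)
proof (induction n arbitrary: y)
  case (Suc n)
  have "(partial_deriv i ^^ Suc n) f y = partial_deriv i (powr_mixed_deriv t p (k(i := k i + n))) y"
    by (simp only: funpow.simps o_apply) (rule partial_deriv_cong_ball[OF Suc.IH Suc.prems])
  also have "\<dots> = powr_mixed_deriv t p (k(i := k i + Suc n)) y"
    using partial_deriv_powr_mixed_deriv[OF Suc.prems, of i p "k(i := k i + n)"] by simp
  finally show ?case .
qed (simp add: assms)

lemma coords: "distinct (coords :: 'd::finite list)" "set (coords :: 'd list) = UNIV"
proof -
  have "\<exists>is :: 'd list. distinct is \<and> set is = UNIV"
    using finite_distinct_list[of "UNIV :: 'd set"] by auto
  from someI_ex[OF this] show "distinct (coords :: 'd list)" "set (coords :: 'd list) = UNIV"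
    unfolding coords_def by auto
qed

lemma mixed_deriv_powr:
  fixes y :: "real ^ 'd"
  assumes "norm y < t"
  shows "mixed_deriv k (\<lambda>y. (t^2 - (norm y)^2) powr p) y = powr_mixed_deriv t p k y"
proof -
  let ?f = "\<lambda>y :: real ^ 'd. (t^2 - (norm y)^2) powr p"
  have "half_splits (\<lambda>_. 0 :: nat) = {(\<lambda>_. 0, \<lambda>_ :: 'd. 0)}"
    by (auto simp: half_splits_def fun_eq_iff)
  then have base: "?f y = powr_mixed_deriv t p (\<lambda>_. 0) y" for y
    by (simp add: powr_mixed_deriv_def mfact_def rodrigues_term_def mdeg_def)
  \<comment> \<open>The induction over the coordinate list keeps the entries of \<open>k\<close> at
    the coordinates treated so far and 0 elsewhere; distinctness ensures that each coordinate starts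
    from 0.\<close>
  have "foldr (\<lambda>i. partial_deriv i ^^ k i) is ?f y = powr_mixed_deriv t p (\<lambda>i. if i \<in> set is then k i else 0) y"
    if "distinct is" "norm y < t" for "is" y
    using that
  proof (induction "is" arbitrary: y)
    case Nil
    then show ?case by (simp add: base)
  next
    case (Cons i "is")
    have "foldr (\<lambda>i. partial_deriv i ^^ k i) (i # is) ?f y
        = (partial_deriv i ^^ k i) (foldr (\<lambda>i. partial_deriv i ^^ k i) is ?f) y" by simp
    also have "\<dots> = powr_mixed_deriv t p ((\<lambda>i. if i \<in> set is then k i else 0)
        (i := (\<lambda>i. if i \<in> set is then k i else 0) i + k i)) y"
      by (rule partial_deriv_funpow_powr_mixed_deriv) (use Cons in auto)
    also have "(\<lambda>i. if i \<in> set is then k i else 0)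
        (i := (\<lambda>i. if i \<in> set is then k i else 0) i + k i) = (\<lambda>m. if m \<in> set (i # is) then k m else 0)"
      using Cons.prems by auto
    finally show ?case .
  qed
  from this[OF coords(1) assms] show ?thesis
    unfolding mixed_deriv_def by (simp add: coords(2))
qed

section \<open>Laguerre polynomials and the explicit form of UL\<close>

text \<open>The classical Laguerre polynomial with parameter \<open>a\<close>: the last quotient is
  the generalized binomial coefficient N + a over N - i, in a form that makes sense for every real
  \<open>a\<close>.\<close>

definition laguerre :: "nat \<Rightarrow> real \<Rightarrow> real \<Rightarrow> real" where
  "laguerre N a t = (\<Sum>i\<le>N. (- t) ^ i / fact i * (pochhammer (a + 1 + real i) (N - i) / fact (N - i)))"

lemma falling_factorial_pochhammer: "falling_factorial (a + real M) M = pochhammer (a + 1) M"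
  unfolding falling_factorial_def pochhammer_prod atLeast0LessThan
  by (rule prod.reindex_bij_witness[where i = "\<lambda>i. M - Suc i" and j = "\<lambda>i. M - Suc i"])
    (auto simp: of_nat_diff)

text \<open>The inductive step of the Leibniz formula: \<open>g i M\<close> stands for
  \<open>i\<close> derivatives on one factor and \<open>M\<close> on the other, and Pascal's rule
  merges neighbours.\<close>

lemma pascal_sum:
  fixes g :: "nat \<Rightarrow> nat \<Rightarrow> real"
  shows "(\<Sum>i\<le>N. real (N choose i) * (g i (Suc (N - i)) + g (Suc i) (N - i)))
    = (\<Sum>i\<le>Suc N. real (Suc N choose i) * g i (Suc N - i))"
proof -
  have "(\<Sum>i\<le>Suc N. real (Suc N choose i) * g i (Suc N - i))
      = g 0 (Suc N) + (\<Sum>i\<le>N. real (Suc N choose Suc i) * g (Suc i) (N - i))"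
    by (subst sum.atMost_Suc_shift) simp
  also have "\<dots> = g 0 (Suc N) + (\<Sum>i\<le>N. real (N choose Suc i) * g (Suc i) (N - i))
      + (\<Sum>i\<le>N. real (N choose i) * g (Suc i) (N - i))"
    by (simp add: sum.distrib algebra_simps)
  also have "g 0 (Suc N) + (\<Sum>i\<le>N. real (N choose Suc i) * g (Suc i) (N - i))
      = (\<Sum>i\<le>Suc N. real (N choose i) * g i (Suc N - i))"
    by (subst sum.atMost_Suc_shift) simp
  also have "\<dots> = (\<Sum>i\<le>N. real (N choose i) * g i (Suc (N - i)))"
    by (simp add: Suc_diff_le)
  finally show ?thesis by (simp add: sum.distrib algebra_simps)
qed

lemma higher_deriv_powr_exp:
  fixes t :: real
  assumes "t > 0"
  shows "(deriv ^^ N) (\<lambda>s. s powr p * exp (- s)) t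
    = (\<Sum>i\<le>N. real (N choose i) * ((- 1) ^ i * falling_factorial p (N - i) * t powr (p - real (N - i)) * exp (- t)))"
  using assms
proof (induction N arbitrary: t)
  case (Suc N)
  \<comment> \<open>The product of the \<open>i\<close>-th derivative of \<open>exp (- s)\<close>
    and the \<open>M\<close>-th derivative of \<open>s powr p\<close>, taken at
    \<open>t\<close>.\<close>
  define g where "g t i M = (- 1) ^ i * falling_factorial p M * t powr (p - real M) * exp (- t)" for t i M
  have g: "((\<lambda>t. g t i M) has_real_derivative g t i (Suc M) + g t (Suc i) M) (at t)" for i M
    unfolding g_def using Suc.prems
    by (auto intro!: derivative_eq_intros simp: algebra_simps)
  have "(deriv ^^ Suc N) (\<lambda>s. s powr p * exp (- s)) t
      = deriv (\<lambda>t. \<Sum>i\<le>N. real (N choose i) * g t i (N - i)) t"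
  proof (simp only: funpow.simps o_apply, rule deriv_cong_ev)
    have "eventually (\<lambda>x. x \<in> {0<..}) (nhds t)"
      by (rule eventually_nhds_in_open) (use Suc.prems in auto)
    then show "\<forall>\<^sub>F x in nhds t. (deriv ^^ N) (\<lambda>s. s powr p * exp (- s)) x
        = (\<Sum>i\<le>N. real (N choose i) * g x i (N - i))"
      by eventually_elim (simp add: Suc.IH g_def)
  qed simp
  also have "\<dots> = (\<Sum>i\<le>N. real (N choose i) * (g t i (Suc (N - i)) + g t (Suc i) (N - i)))"
    by (rule DERIV_imp_deriv) (intro DERIV_sum DERIV_cmult g)
  also have "\<dots> = (\<Sum>i\<le>Suc N. real (Suc N choose i) * g t i (Suc N - i))"
    by (rule pascal_sum)
  finally show ?case by (simp only: g_def)
qed simp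

text \<open>Rodrigues' formula for Laguerre polynomials. The Leibniz sum matches term by term, the
  binomial coefficient supplying the two factorials.\<close>

lemma rodrigues_laguerre:
  fixes t :: real
  assumes "t > 0"
  shows "(deriv ^^ N) (\<lambda>s. s powr (real N + a) * exp (- s)) t
    = fact N * t powr a * exp (- t) * laguerre N a t"
proof -
  have "real (N choose i) * ((- 1) ^ i * falling_factorial (real N + a) (N - i) * t powr (real N + a - real (N - i)) * exp (- t))
      = fact N * t powr a * exp (- t) * ((- t) ^ i / fact i * (pochhammer (a + 1 + real i) (N - i) / fact (N - i)))"
    if "i \<le> N" for i
  proof -
    have "falling_factorial (real N + a) (N - i) = pochhammer (a + 1 + real i) (N - i)"
      using falling_factorial_pochhammer[of "a + real i" "N - i"] that by (simp add: of_nat_diff algebra_simps)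
    moreover have "t powr (real N + a - real (N - i)) = t powr a * t ^ i"
      using that assms by (simp add: of_nat_diff powr_add powr_realpow)
    moreover have "real (N choose i) = fact N / (fact i * fact (N - i))"
      using that by (rule binomial_fact)
    moreover have "(- t) ^ i = (- 1) ^ i * t ^ i" by (rule power_minus)
    ultimately show ?thesis by simp
  qed
  then show ?thesis
    unfolding higher_deriv_powr_exp[OF assms] laguerre_def sum_distrib_left by (intro sum.cong) auto
qed

section \<open>The explicit polynomial on the whole cone\<close>

definition UL_poly ::
    "real \<Rightarrow> real \<Rightarrow> ('d::finite \<Rightarrow> nat) \<Rightarrow> nat \<Rightarrow> (real ^ 'd) \<times> real \<Rightarrow> real" where
  "UL_poly \<beta> \<mu> k n z = fact (n - mdeg k)
     * laguerre (n - mdeg k) (2 * real (mdeg k) + \<beta> + 2 * \<mu> + real CARD('d) - 1) (snd z)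
     * (mfact k * (\<Sum>(l, j)\<in>half_splits k.
         (\<Prod>i\<in>UNIV. (- 2 * fst z $ i) ^ l i / fact (l i) * ((- 1) ^ j i / fact (j i)))
         * falling_factorial (real (mdeg k) + \<mu> - 1/2) (mdeg l + mdeg j)
         * ((snd z)^2 - (norm (fst z))^2) ^ mdeg j))"

lemma half_splits_mdeg: "(l, j) \<in> half_splits k \<Longrightarrow> mdeg k = mdeg l + 2 * mdeg j"
  unfolding half_splits_def mdeg_def by (simp add: sum_distrib_left flip: sum.distrib)

text \<open>The weight and the powers of \<open>t\<close> cancel. For a splitting of
  \<open>k\<close> the exponent left on the quadratic is
  \<open>mdeg k - mdeg l - mdeg j = mdeg j\<close>, a natural number, which is why a polynomial
  results.\<close>

lemma UL_rodrigues_eq_UL_poly: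
  fixes x :: "real ^ 'd"
  assumes "norm x < t" and "mdeg k \<le> n"
  shows "UL_rodrigues \<beta> \<mu> k n (x, t) = UL_poly \<beta> \<mu> k n (x, t)"
proof -
  define m where "m = mdeg k"
  define N where "N = n - m"
  define q where "q = t^2 - (norm x)^2"
  define a where "a = 2 * real m + \<beta> + 2 * \<mu> + real CARD('d) - 1"
  define S where "S = mfact k * (\<Sum>(l, j)\<in>half_splits k.
         (\<Prod>i\<in>UNIV. (- 2 * x $ i) ^ l i / fact (l i) * ((- 1) ^ j i / fact (j i)))
         * falling_factorial (real m + \<mu> - 1/2) (mdeg l + mdeg j) * q ^ mdeg j)"
  have t: "t > 0" using assms(1) by (meson le_less_trans norm_ge_zero)
  have q: "q > 0" unfolding q_def using assms(1) by (simp add: power_strict_mono)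
  have n: "real n + real m + \<beta> + 2 * \<mu> + real CARD('d) - 1 = real N + a"
    using assms(2) by (simp add: a_def N_def m_def of_nat_diff)
  have "powr_mixed_deriv t (real m + \<mu> - 1/2) k x = q powr (\<mu> - 1/2) * S"
    unfolding powr_mixed_deriv_def S_def rodrigues_term_def q_def[symmetric] sum_distrib_left mult.left_commute[of "q powr _" "mfact k"] case_prod_unfold
  proof (rule sum.cong[OF refl], goal_cases)
    case (1 lj)
    obtain l j where lj: "lj = (l, j)" by (cases lj)
    with 1 have "m = mdeg l + 2 * mdeg j" unfolding m_def by (intro half_splits_mdeg) simp
    then have "real m + \<mu> - 1/2 - real (mdeg l + mdeg j) = (\<mu> - 1/2) + real (mdeg j)" by simp
    then have "q powr (real m + \<mu> - 1/2 - real (mdeg l + mdeg j)) = q powr (\<mu> - 1/2) * q ^ mdeg j"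
      using q by (simp only: powr_add powr_realpow)
    then show ?case by (simp add: lj)
  qed
  then have mx: "mixed_deriv k (\<lambda>y. (t^2 - (norm y)^2) powr (real m + \<mu> - 1/2)) x = q powr (\<mu> - 1/2) * S"
    by (simp only: mixed_deriv_powr[OF assms(1)])
  have pw: "t powr a = t powr \<beta> * t powr (2 * real m + 2 * \<mu> + real CARD('d) - 1)"
    unfolding a_def powr_add[symmetric] by (simp add: algebra_simps)
  have "UL_rodrigues \<beta> \<mu> k n (x, t) = 1 / (q powr (\<mu> - 1/2) * t powr \<beta> * exp (- t))
     * (1 / t powr (2 * real m + 2 * \<mu> + real CARD('d) - 1)) * (q powr (\<mu> - 1/2) * S)
     * (fact N * t powr a * exp (- t) * laguerre N a t)"
    unfolding UL_rodrigues_def cone_weight_def prod.case m_def[symmetric] N_def[symmetric] n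
      mx rodrigues_laguerre[OF t] q_def[symmetric] by simp
  also have "\<dots> = fact N * laguerre N a t * S"
    using q t unfolding pw by (simp add: field_simps)
  finally show ?thesis
    unfolding UL_poly_def S_def q_def a_def N_def m_def by simp
qed

lemma real_polynomial_UL_poly: "real_polynomial_function (UL_poly \<beta> \<mu> k n :: (real ^ 'd) \<times> real \<Rightarrow> real)"
proof -
  have f: "real_polynomial_function (\<lambda>z :: (real ^ 'd) \<times> real. fst z $ i)" for i
    by (intro real_polynomial_function.intros(1) bounded_linear_compose[OF bounded_linear_vec_nth bounded_linear_fst])
  have s: "real_polynomial_function (\<lambda>z :: (real ^ 'd) \<times> real. snd z)"
    by (intro real_polynomial_function.intros(1) bounded_linear_snd)
  have norm: "(norm (fst z))^2 = (\<Sum>i\<in>UNIV. (fst z $ i)^2)" for z :: "(real ^ 'd) \<times> real"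
    by (simp add: norm_vec_def L2_set_def sum_nonneg)
  show ?thesis
    unfolding UL_poly_def laguerre_def norm case_prod_unfold
    by (intro real_polynomial_function.intros(2,4) real_polynomial_function_sum
        real_polynomial_function_prod real_polynomial_function_power real_polynomial_function_diff
        real_polynomial_function_divide real_polynomial_function_minus f s finite_half_splits) auto
qed

text \<open>On the line through \<open>u\<close> and \<open>z\<close> the difference is a polynomial
  in one variable that vanishes on an open set around 0, hence at infinitely many points.\<close>

lemma real_polynomial_function_eqI:
  fixes P Q :: "'a::real_normed_vector \<Rightarrow> real"
  assumes "real_polynomial_function P" and "real_polynomial_function Q"
    and "open U" and "u \<in> U" and "\<And>z. z \<in> U \<Longrightarrow> P z = Q z"
  shows "P = Q"
proof
  fix z
  define h where "h s = u + s *\<^sub>R (z - u)" for s :: real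
  have "polynomial_function h"
    unfolding h_def by (intro polynomial_function_add polynomial_function_const polynomial_function_bounded_linear bounded_linear_scaleR_left)
  moreover have "real_polynomial_function (\<lambda>z. P z - Q z)"
    using assms by (intro real_polynomial_function_diff)
  ultimately have "real_polynomial_function ((\<lambda>z. P z - Q z) \<circ> h)"
    by (rule real_polynomial_function_compose)
  then obtain a n where a: "(\<lambda>z. P z - Q z) \<circ> h = (\<lambda>x. \<Sum>i\<le>n. a i * x ^ i)"
    unfolding real_polynomial_function_iff_sum by blast
  have "continuous_on UNIV h" unfolding h_def by (intro continuous_intros)
  then have "open (h -` U)" using assms(3) by (simp add: open_vimage)
  moreover have "0 \<in> h -` U" using assms(4) by (simp add: h_def)
  ultimately have "infinite (h -` U)" using finite_imp_not_open by blast
  moreover have "h -` U \<subseteq> {x. (\<Sum>i\<le>n. a i * x ^ i) = 0}"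
    using assms(5) by (auto simp: fun_eq_iff[THEN iffD1, OF a, rule_format, symmetric])
  ultimately have "infinite {x. (\<Sum>i\<le>n. a i * x ^ i) = 0}"
    using finite_subset by blast
  then have "\<forall>i\<le>n. a i = 0" unfolding polyfun_finite_roots by blast
  then have "P (h 1) - Q (h 1) = 0"
    using fun_cong[OF a, of 1] by simp
  then show "P z = Q z" by (simp add: h_def)
qed

text \<open>This is an equality of functions, so boundary points are included: the open interior of
  the cone already determines the polynomial.\<close>

lemma UL_eq_UL_poly:
  assumes "mdeg k \<le> n"
  shows "UL \<beta> \<mu> k n = (UL_poly \<beta> \<mu> k n :: (real ^ 'd) \<times> real \<Rightarrow> real)"
  unfolding UL_def
proof (rule the_equality)
  show "real_polynomial_function (UL_poly \<beta> \<mu> k n :: (real ^ 'd) \<times> real \<Rightarrow> real) \<and>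
     (\<forall>x t. norm x < t \<longrightarrow> UL_poly \<beta> \<mu> k n (x, t) = UL_rodrigues \<beta> \<mu> k n (x, t))"
    using real_polynomial_UL_poly UL_rodrigues_eq_UL_poly[OF _ assms] by simp
next
  fix P :: "(real ^ 'd) \<times> real \<Rightarrow> real"
  assume P: "real_polynomial_function P \<and>
     (\<forall>x t. norm x < t \<longrightarrow> P (x, t) = UL_rodrigues \<beta> \<mu> k n (x, t))"
  show "P = UL_poly \<beta> \<mu> k n"
  proof (rule real_polynomial_function_eqI)
    show "open {z :: (real ^ 'd) \<times> real. norm (fst z) < snd z}"
      by (intro open_Collect_less continuous_intros)
    show "(0, 1) \<in> {z :: (real ^ 'd) \<times> real. norm (fst z) < snd z}" by simp
  qed (use P UL_rodrigues_eq_UL_poly[OF _ assms] real_polynomial_UL_poly in auto)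
qed

section \<open>The sum over multi-indices of fixed degree\<close>

lemma divided_binomial:
  fixes a s :: real
  shows "(\<Sum>v\<le>M. a ^ v / fact v * (s ^ (M - v) / fact (M - v))) = (a + s) ^ M / fact M"
proof -
  have "(a + s) ^ M / fact M = (\<Sum>v\<le>M. real (M choose v) * a ^ v * s ^ (M - v) / fact M)"
    by (simp add: binomial_ring sum_divide_distrib)
  also have "\<dots> = (\<Sum>v\<le>M. a ^ v / fact v * (s ^ (M - v) / fact (M - v)))"
    by (rule sum.cong[OF refl]) (simp add: binomial_fact)
  finally show ?thesis ..
qed

text \<open>The multinomial theorem in divided powers: the value \<open>v\<close> at the new element
  is split off and the binomial theorem applied. Requiring \<open>l\<close> to vanish off
  \<open>S\<close> makes each multi-index on \<open>S\<close> occur exactly once.\<close>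

lemma divided_multinomial_on:
  fixes a :: "'i \<Rightarrow> real"
  assumes "finite S"
  shows "(\<Sum>l | (\<forall>i. i \<notin> S \<longrightarrow> l i = 0) \<and> sum l S = M. \<Prod>i\<in>S. a i ^ l i / fact (l i))
    = (\<Sum>i\<in>S. a i) ^ M / fact M"
  using assms
proof (induction S arbitrary: M rule: finite_induct)
  case empty
  have "{l :: 'i \<Rightarrow> nat. (\<forall>i. l i = 0) \<and> 0 = M} = (if M = 0 then {\<lambda>_. 0} else {})"
    by auto
  then show ?case by (cases "M = 0") (simp_all add: fun_eq_iff)
next
  case (insert i S)
  define L where "L S M = {l :: 'i \<Rightarrow> nat. (\<forall>i. i \<notin> S \<longrightarrow> l i = 0) \<and> sum l S = M}" for S M
  have fin: "finite (L S M)" if "finite S" for S M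
  proof (rule finite_subset)
    show "L S M \<subseteq> {l. \<forall>i. (i \<in> S \<longrightarrow> l i \<in> {..M}) \<and> (i \<notin> S \<longrightarrow> l i = 0)}"
      unfolding L_def using that by (auto intro: member_le_sum)
    show "finite {l. \<forall>i. (i \<in> S \<longrightarrow> l i \<in> {..M}) \<and> (i \<notin> S \<longrightarrow> l i = (0 :: nat))}"
      using finite_set_of_finite_funs[OF that finite_atMost[of M]] by simp
  qed
  have upd: "sum (l(i := v)) S = sum l S" "(\<Prod>m\<in>S. a m ^ (l(i := v)) m / fact ((l(i := v)) m)) = (\<Prod>m\<in>S. a m ^ l m / fact (l m))" for l v
    using insert.hyps by (auto intro!: sum.cong prod.cong)
  have "(\<Sum>l\<in>L (insert i S) M. \<Prod>m\<in>insert i S. a m ^ l m / fact (l m))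
      = (\<Sum>(v, l)\<in>(SIGMA v:{..M}. L S (M - v)). a i ^ v / fact v * (\<Prod>m\<in>S. a m ^ l m / fact (l m)))"
  proof (rule sum.reindex_bij_witness[where j = "\<lambda>l. (l i, l(i := 0))" and i = "\<lambda>(v, l). l(i := v)"], goal_cases)
    case (1 l)
    then show ?case by (simp add: fun_upd_idem)
  next
    case (2 l)
    have "(\<Sum>m\<in>S. if m = i then 0 else l m) = sum l S"
      using insert.hyps by (intro sum.cong) auto
    with 2 show ?case using insert.hyps unfolding L_def by auto
  next
    case (3 p)
    then show ?case using insert.hyps unfolding L_def by (auto simp: fun_upd_idem)
  next
    case (4 p)
    have "(\<Sum>m\<in>S. if m = i then v else l m) = sum l S" for v :: nat and l
      using insert.hyps by (intro sum.cong) auto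
    with 4 show ?case using insert.hyps unfolding L_def by auto
  next
    case (5 l)
    then show ?case using insert.hyps by (simp add: upd del: fun_upd_apply)
  qed
  also have "\<dots> = (\<Sum>v\<le>M. a i ^ v / fact v * (\<Sum>l\<in>L S (M - v). \<Prod>m\<in>S. a m ^ l m / fact (l m)))"
    using fin[OF insert.hyps(1)] by (subst sum.Sigma[symmetric]) (simp_all add: sum_distrib_left)
  also have "\<dots> = (\<Sum>v\<le>M. a i ^ v / fact v * ((\<Sum>i\<in>S. a i) ^ (M - v) / fact (M - v)))"
    using insert.IH unfolding L_def by simp
  also have "\<dots> = (\<Sum>i\<in>insert i S. a i) ^ M / fact M"
    unfolding divided_binomial using insert.hyps by simp
  finally show ?case unfolding L_def .
qed

lemma divided_multinomial:
  fixes a :: "'d::finite \<Rightarrow> real"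
  shows "(\<Sum>l | mdeg l = M. \<Prod>i\<in>UNIV. a i ^ l i / fact (l i)) = (\<Sum>i\<in>UNIV. a i) ^ M / fact M"
  using divided_multinomial_on[of UNIV a M] by (simp add: mdeg_def)

text \<open>A splitting determines \<open>k\<close>, so the double sum runs over all pairs with
  \<open>mdeg l + 2 * mdeg j = m\<close>. For fixed \<open>J = mdeg j\<close> the factor
  \<open>\<phi>\<close> depends on \<open>m - J\<close> alone, and \<open>l\<close> and
  \<open>j\<close> vary independently. Two multinomial sums then produce
  \<open>- 2 * (b \<bullet> x)\<close> and \<open>- ((norm b)^2)\<close>.\<close>

lemma sum_half_splits:
  fixes b x :: "real ^ 'd" and \<phi> :: "nat \<Rightarrow> real"
  shows "(\<Sum>k | mdeg k = m. mpow b k * (\<Sum>(l, j)\<in>half_splits k.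
         (\<Prod>i\<in>UNIV. (- 2 * x $ i) ^ l i / fact (l i) * ((- 1) ^ j i / fact (j i)))
         * \<phi> (mdeg l + mdeg j) * q ^ mdeg j))
    = (\<Sum>J\<le>m div 2. \<phi> (m - J) * q ^ J * ((- 2 * (b \<bullet> x)) ^ (m - 2 * J) / fact (m - 2 * J))
         * ((- ((norm b)^2)) ^ J / fact J))"
proof -
  define f where "f l j = (\<Prod>i\<in>UNIV. (- 2 * (b $ i * x $ i)) ^ l i / fact (l i))
       * (\<Prod>i\<in>UNIV. (- ((b $ i)^2)) ^ j i / fact (j i)) * \<phi> (mdeg l + mdeg j) * q ^ mdeg j" for l j
  have "mpow b k * (\<Sum>(l, j)\<in>half_splits k.
         (\<Prod>i\<in>UNIV. (- 2 * x $ i) ^ l i / fact (l i) * ((- 1) ^ j i / fact (j i)))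
         * \<phi> (mdeg l + mdeg j) * q ^ mdeg j) = (\<Sum>(l, j)\<in>half_splits k. f l j)" for k
    unfolding sum_distrib_left case_prod_unfold
  proof (rule sum.cong[OF refl], goal_cases)
    case (1 lj)
    obtain l j where lj: "lj = (l, j)" by (cases lj)
    have k: "k i = l i + 2 * j i" for i
      using 1 unfolding lj half_splits_def by simp
    have "b $ i ^ k i * ((- 2 * x $ i) ^ l i / fact (l i) * ((- 1) ^ j i / fact (j i)))
        = (- 2 * (b $ i * x $ i)) ^ l i / fact (l i) * ((- ((b $ i)^2)) ^ j i / fact (j i))" for i
    proof -
      have "(- ((b $ i)^2)) ^ j i = (-1) ^ j i * (b $ i) ^ (2 * j i)"
        by (subst power_minus) (simp add: power_mult)
      moreover have "(- 2 * (b $ i * x $ i)) ^ l i = (b $ i) ^ l i * (- 2 * x $ i) ^ l i"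
        by (simp add: power_mult_distrib[symmetric] mult_ac)
      ultimately show ?thesis by (simp add: k power_add)
    qed
    then have "mpow b k * (\<Prod>i\<in>UNIV. (- 2 * x $ i) ^ l i / fact (l i) * ((- 1) ^ j i / fact (j i)))
        = (\<Prod>i\<in>UNIV. (- 2 * (b $ i * x $ i)) ^ l i / fact (l i)) * (\<Prod>i\<in>UNIV. (- ((b $ i)^2)) ^ j i / fact (j i))"
      unfolding mpow_def prod.distrib[symmetric] by (intro prod.cong refl)
    then show ?case by (simp add: lj f_def flip: mult.assoc)
  qed
  then have "(\<Sum>k | mdeg k = m. mpow b k * (\<Sum>(l, j)\<in>half_splits k.
         (\<Prod>i\<in>UNIV. (- 2 * x $ i) ^ l i / fact (l i) * ((- 1) ^ j i / fact (j i)))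
         * \<phi> (mdeg l + mdeg j) * q ^ mdeg j)) = (\<Sum>k | mdeg k = m. \<Sum>(l, j)\<in>half_splits k. f l j)"
    by (intro sum.cong) auto
  also have "\<dots> = (\<Sum>(k, l, j)\<in>(SIGMA k:{k. mdeg k = m}. half_splits k). f l j)"
    by (subst sum.Sigma) (auto simp: finite_mdeg_eq finite_half_splits)
  also have "\<dots> = (\<Sum>(J, l, j)\<in>(SIGMA J:{..m div 2}. {l. mdeg l = m - 2 * J} \<times> {j. mdeg j = J}). f l j)"
  proof (rule sum.reindex_bij_witness[where j = "\<lambda>(k, l, j). (mdeg j, l, j)"
          and i = "\<lambda>(J, l, j). (\<lambda>i. l i + 2 * j i, l, j)"], goal_cases)
    case (1 p)
    then show ?case by (auto simp: half_splits_def)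
  next
    case (2 p)
    then show ?case by (auto dest!: half_splits_mdeg)
  next
    case (4 p)
    then show ?case
      by (auto simp: half_splits_def mdeg_def sum.distrib sum_distrib_left[symmetric])
  qed auto
  also have "\<dots> = (\<Sum>J\<le>m div 2. \<Sum>l | mdeg l = m - 2 * J. \<Sum>j | mdeg j = J. f l j)"
    by (subst sum.Sigma[symmetric]) (auto simp: finite_mdeg_eq sum.cartesian_product)
  also have "\<dots> = (\<Sum>J\<le>m div 2. \<phi> (m - J) * q ^ J * ((- 2 * (b \<bullet> x)) ^ (m - 2 * J) / fact (m - 2 * J))
         * ((- ((norm b)^2)) ^ J / fact J))"
  proof (rule sum.cong[OF refl])
    fix J assume "J \<in> {..m div 2}"
    then have J: "m - 2 * J + J = m - J" by simp
    have c: "(\<Sum>i\<in>UNIV. - 2 * (b $ i * x $ i)) = - 2 * (b \<bullet> x)"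
      by (simp add: inner_vec_def sum_distrib_left sum_negf)
    have n: "(\<Sum>i\<in>UNIV. - ((b $ i)^2)) = - ((norm b)^2)"
      by (simp add: norm_vec_def L2_set_def sum_nonneg sum_negf)
    have "(\<Sum>l | mdeg l = m - 2 * J. \<Sum>j | mdeg j = J. f l j)
        = (\<Sum>l | mdeg l = m - 2 * J. \<Sum>j | mdeg j = J. (\<Prod>i\<in>UNIV. (- 2 * (b $ i * x $ i)) ^ l i / fact (l i))
          * ((\<Prod>i\<in>UNIV. (- ((b $ i)^2)) ^ j i / fact (j i)) * (\<phi> (m - J) * q ^ J)))"
      by (intro sum.cong refl) (auto simp: f_def J)
    also have "\<dots> = (\<Sum>l | mdeg l = m - 2 * J. \<Prod>i\<in>UNIV. (- 2 * (b $ i * x $ i)) ^ l i / fact (l i))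
          * ((\<Sum>j | mdeg j = J. \<Prod>i\<in>UNIV. (- ((b $ i)^2)) ^ j i / fact (j i)) * (\<phi> (m - J) * q ^ J))"
      by (simp only: sum_distrib_left[symmetric] sum_distrib_right[symmetric])
    also have "\<dots> = \<phi> (m - J) * q ^ J * ((- 2 * (b \<bullet> x)) ^ (m - 2 * J) / fact (m - 2 * J))
         * ((- ((norm b)^2)) ^ J / fact J)"
      unfolding divided_multinomial c n by simp
    finally show "(\<Sum>l | mdeg l = m - 2 * J. \<Sum>j | mdeg j = J. f l j) = \<dots>" .
  qed
  finally show ?thesis .
qed

text \<open>The coefficient of \<open>w\<^sup>m\<close> in \<open>((1 - c w)\<^sup>2 + e w\<^sup>2) powr - \<mu>\<close>.\<close>

definition gegenbauer :: "real \<Rightarrow> real \<Rightarrow> real \<Rightarrow> nat \<Rightarrow> real" where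
  "gegenbauer \<mu> e c m = (\<Sum>J\<le>m div 2. pochhammer \<mu> J / fact J * (- e) ^ J
     * (c ^ (m - 2 * J) * (pochhammer (2 * \<mu> + 2 * real J) (m - 2 * J) / fact (m - 2 * J))))"

text \<open>The duplication formula splits \<open>pochhammer (2 * \<mu>) (2 * J)\<close> into a
  power of 2, \<open>pochhammer \<mu> J\<close> and \<open>pochhammer (\<mu> + 1/2) J\<close>. The
  last of these and the falling factorial together cancel \<open>pochhammer (\<mu> + 1/2) m\<close>,
  which is nonzero for \<open>\<mu> > - 1/2\<close>.\<close>

lemma gegenbauer_rodrigues:
  assumes "\<mu> > - 1/2"
  shows "(- 1) ^ m * pochhammer (2 * \<mu>) m / (2 ^ m * pochhammer (\<mu> + 1/2) m)
      * (\<Sum>J\<le>m div 2. falling_factorial (real m + \<mu> - 1/2) (m - J) * q ^ J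
         * ((- 2 * c) ^ (m - 2 * J) / fact (m - 2 * J)) * ((- B) ^ J / fact J))
    = gegenbauer \<mu> (B * q) c m"
  unfolding gegenbauer_def sum_distrib_left
proof (rule sum.cong[OF refl])
  fix J assume "J \<in> {..m div 2}"
  then have J: "2 * J \<le> m" by auto
  define i where "i = m - 2 * J"
  have m: "m = i + 2 * J" "m - J = i + J" using J by (auto simp: i_def)
  define P where "P = pochhammer (\<mu> + 1/2) J"
  define Q where "Q = pochhammer (\<mu> + 1/2 + real J) (i + J)"
  define R where "R = pochhammer (2 * \<mu> + 2 * real J) i"
  have f: "falling_factorial (real m + \<mu> - 1/2) (m - J) = Q"
    using falling_factorial_pochhammer[of "\<mu> - 1/2 + real J" "i + J"] unfolding m Q_def by (simp add: algebra_simps)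
  have p1: "pochhammer (\<mu> + 1/2) m = P * Q"
    using pochhammer_product'[of "\<mu> + 1/2" J "i + J"] unfolding m P_def Q_def
    by (simp add: mult_2 add_ac)
  have p2: "pochhammer (2 * \<mu>) m = 2 ^ (2 * J) * pochhammer \<mu> J * P * R"
    using pochhammer_product'[of "2 * \<mu>" "2 * J" i] pochhammer_double[of \<mu> J]
    unfolding m P_def R_def by (simp add: add_ac)
  have nz: "P > 0" "Q > 0"
    unfolding P_def Q_def using assms by (auto intro!: pochhammer_pos)
  have s: "(- 2 * c) ^ i = (- 1) ^ i * 2 ^ i * c ^ i"
    by (metis mult.assoc mult_minus1 power_mult_distrib)
  have s1: "(-1::real) ^ m = (-1) ^ i" unfolding m by (simp add: power_add)
  have s2: "(-1::real) ^ i * (-1) ^ i = 1" by (simp flip: power_mult_distrib)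
  have s3: "(2::real) ^ m = 2 ^ i * 2 ^ (2 * J)" unfolding m by (simp add: power_add)
  have s4: "(- (B * q)) ^ J = (- B) ^ J * q ^ J" by (simp flip: power_mult_distrib)
  have "(- 1) ^ m * pochhammer (2 * \<mu>) m / (2 ^ m * pochhammer (\<mu> + 1/2) m) * (falling_factorial (real m + \<mu> - 1/2) (m - J) * q ^ J
         * ((- 2 * c) ^ i / fact i) * ((- B) ^ J / fact J))
     = ((-1) ^ i * (-1) ^ i) * (2 ^ (2 * J) * pochhammer \<mu> J * P * R / (2 ^ i * 2 ^ (2 * J) * (P * Q)) * (Q * q ^ J
         * (2 ^ i * c ^ i / fact i) * ((- B) ^ J / fact J)))"
    unfolding f p1 p2 s s1 s3 by simp
  also have "\<dots> = pochhammer \<mu> J / fact J * (- (B * q)) ^ J * (c ^ i * (R / fact i))"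
    unfolding s2 s4 using nz by (simp add: field_simps)
  finally show "(- 1) ^ m * pochhammer (2 * \<mu>) m / (2 ^ m * pochhammer (\<mu> + 1/2) m) * (falling_factorial (real m + \<mu> - 1/2) (m - J) * q ^ J
         * ((- 2 * c) ^ (m - 2 * J) / fact (m - 2 * J)) * ((- B) ^ J / fact J))
     = pochhammer \<mu> J / fact J * (- (B * q)) ^ J
     * (c ^ (m - 2 * J) * (pochhammer (2 * \<mu> + 2 * real J) (m - 2 * J) / fact (m - 2 * J)))"
    unfolding i_def R_def .
qed

lemma mdeg_le_Union: "{k. mdeg k \<le> n} = (\<Union>m\<le>n. {k. mdeg k = m})"
  by auto

text \<open>Grouped by degree, the factorials \<open>mfact k\<close> and \<open>fact (n - m)\<close>
  of the coefficients cancel those of the explicit polynomial.\<close>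

lemma UL_gf_term_eq:
  fixes b x :: "real ^ 'd"
  assumes "\<mu> > - 1/2"
  shows "UL_gf_term \<beta> \<mu> b x t r n = (\<Sum>m\<le>n. gegenbauer \<mu> ((norm b)^2 * (t^2 - (norm x)^2)) (b \<bullet> x) m
     * laguerre (n - m) (2 * real m + \<beta> + 2 * \<mu> + real CARD('d) - 1) t) * r ^ n"
proof -
  define h where "h k = ((-1) ^ mdeg k * pochhammer (2 * \<mu>) (mdeg k))
     / (2 ^ mdeg k * pochhammer (\<mu> + 1/2) (mdeg k) * mfact k * fact (n - mdeg k))
     * UL \<beta> \<mu> k n (x, t) * mpow b k * r ^ n" for k
  define q where "q = t^2 - (norm x)^2"
  have "(\<Sum>k | mdeg k = m. h k) = gegenbauer \<mu> ((norm b)^2 * q) (b \<bullet> x) m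
     * laguerre (n - m) (2 * real m + \<beta> + 2 * \<mu> + real CARD('d) - 1) t * r ^ n" if m: "m \<le> n" for m
  proof -
    define K where "K = (-1) ^ m * pochhammer (2 * \<mu>) m / (2 ^ m * pochhammer (\<mu> + 1/2) m)"
    define Lg where "Lg = laguerre (n - m) (2 * real m + \<beta> + 2 * \<mu> + real CARD('d) - 1) t"
    define S where "S k = (\<Sum>(l, j)\<in>half_splits k.
         (\<Prod>i\<in>UNIV. (- 2 * x $ i) ^ l i / fact (l i) * ((- 1) ^ j i / fact (j i)))
         * falling_factorial (real m + \<mu> - 1/2) (mdeg l + mdeg j) * q ^ mdeg j)" for k
    have "h k = K * Lg * r ^ n * (mpow b k * S k)" if k: "mdeg k = m" for k
    proof -
      have "mfact k \<noteq> 0" by (simp add: mfact_def)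
      moreover have "UL \<beta> \<mu> k n (x, t) = fact (n - m) * Lg * (mfact k * S k)"
        using m k unfolding Lg_def S_def q_def by (simp add: UL_eq_UL_poly UL_poly_def)
      ultimately show ?thesis unfolding h_def k K_def by simp
    qed
    then have "(\<Sum>k | mdeg k = m. h k) = K * Lg * r ^ n * (\<Sum>k | mdeg k = m. mpow b k * S k)"
      by (simp add: sum_distrib_left)
    also have "\<dots> = (K * (\<Sum>J\<le>m div 2. falling_factorial (real m + \<mu> - 1/2) (m - J) * q ^ J
        * ((- 2 * (b \<bullet> x)) ^ (m - 2 * J) / fact (m - 2 * J)) * ((- ((norm b)^2)) ^ J / fact J))) * (Lg * r ^ n)"
      unfolding S_def sum_half_splits[where \<phi> = "falling_factorial (real m + \<mu> - 1/2)"] by (simp only: mult_ac)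
    also have "\<dots> = gegenbauer \<mu> ((norm b)^2 * q) (b \<bullet> x) m * Lg * r ^ n"
      unfolding K_def gegenbauer_rodrigues[OF assms] by (simp only: mult.assoc)
    finally show ?thesis unfolding Lg_def .
  qed
  moreover have "UL_gf_term \<beta> \<mu> b x t r n = (\<Sum>m\<le>n. \<Sum>k | mdeg k = m. h k)"
    unfolding UL_gf_term_def h_def[symmetric] mdeg_le_Union
    by (rule sum.UNION_disjoint) (auto simp: finite_mdeg_eq)
  ultimately show ?thesis by (simp add: sum_distrib_right q_def)
qed

section \<open>The formal generating function\<close>

text \<open>The series of \<open>(1 - c X) powr - s\<close>.\<close>

definition fps_neg_binomial :: "complex \<Rightarrow> complex \<Rightarrow> complex fps" where
  "fps_neg_binomial c s = Abs_fps (\<lambda>n. pochhammer s n / fact n * c ^ n)"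

lemma fps_neg_binomial_compose:
  "fps_neg_binomial c s = fps_binomial (- s) oo (fps_const (- c) * fps_X)"
proof (rule fps_ext)
  fix n
  have "(- s gchoose n) * (- c) ^ n = ((- 1) ^ n * (- 1) ^ n) * (pochhammer s n / fact n * c ^ n)"
    by (subst power_minus[of c]) (simp add: gbinomial_pochhammer)
  also have "(- 1 :: complex) ^ n * (- 1) ^ n = 1" by (simp flip: power_mult_distrib)
  finally show "fps_neg_binomial c s $ n = (fps_binomial (- s) oo (fps_const (- c) * fps_X)) $ n"
    unfolding fps_compose_linear by (simp add: fps_neg_binomial_def mult_ac)
qed

lemma fps_neg_binomial_add:
  "fps_neg_binomial c (s + s') = fps_neg_binomial c s * fps_neg_binomial c s'"
  using fps_binomial_add_mult[of "- s" "- s'"]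
  by (simp add: fps_neg_binomial_compose fps_compose_mult_distrib)

lemma fps_neg_binomial_power: "fps_neg_binomial c s ^ n = fps_neg_binomial c (of_nat n * s)"
proof (induction n)
  case 0
  have "fps_neg_binomial c 0 = 1"
    by (rule fps_ext) (simp add: fps_neg_binomial_def pochhammer_0_left)
  then show ?case by simp
qed (simp add: distrib_right fps_neg_binomial_add)

lemma has_fps_expansion_neg_binomial:
  "(\<lambda>z. exp (- s * Ln (1 - c * z))) has_fps_expansion fps_neg_binomial c s"
proof -
  have "((\<lambda>z. (1 + z) powr (- s)) \<circ> (\<lambda>z. - c * z)) has_fps_expansion fps_neg_binomial c s"
    unfolding fps_neg_binomial_compose
    by (intro fps_expansion_intros) auto
  \<comment> \<open>Complex \<open>powr\<close> is 0 at base 0, while the form with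
    \<open>exp\<close> and \<open>Ln\<close> never vanishes, so the two are compared where
    \<open>1 - c * z\<close> is nonzero.\<close>
  moreover have "eventually (\<lambda>z. 1 - c * z \<in> - {0}) (nhds 0)"
    by (rule topological_tendstoD[OF tendsto_eq_rhs]) (auto intro!: tendsto_eq_intros filterlim_ident)
  then have "eventually (\<lambda>z. ((\<lambda>z. (1 + z) powr (- s)) \<circ> (\<lambda>z. - c * z)) z = exp (- s * Ln (1 - c * z))) (nhds 0)"
    by eventually_elim (auto simp: powr_def)
  ultimately show ?thesis
    by (subst (asm) has_fps_expansion_cong) auto
qed

text \<open>\<open>G ^ m\<close> starts in degree at least \<open>m\<close>, so only the summands
  with \<open>m \<le> n\<close> reach the coefficient.\<close>

lemma fps_mult_compose_nth:
  fixes A F G :: "complex fps"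
  assumes "fps_nth G 0 = 0"
  shows "fps_nth (A * (F oo G)) n = (\<Sum>m\<le>n. fps_nth F m * fps_nth (A * G ^ m) n)"
proof -
  have *: "fps_nth (F oo G) i = (\<Sum>m\<le>n. fps_nth F m * fps_nth (G ^ m) i)" if "i \<le> n" for i
    unfolding fps_compose_nth
    by (rule sum.mono_neutral_left) (use that startsby_zero_power_prefix[OF assms] in auto)
  have "fps_nth (A * (F oo G)) n = (\<Sum>i=0..n. fps_nth A (n - i) * fps_nth (F oo G) i)"
    by (simp only: mult.commute[of A] fps_mult_nth) (simp only: mult.commute)
  also have "\<dots> = (\<Sum>i=0..n. \<Sum>m\<le>n. fps_nth F m * (fps_nth A (n - i) * fps_nth (G ^ m) i))"
    by (intro sum.cong refl) (simp add: * sum_distrib_left mult_ac)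
  also have "\<dots> = (\<Sum>m\<le>n. fps_nth F m * fps_nth (G ^ m * A) n)"
    by (subst sum.swap) (simp only: fps_mult_nth sum_distrib_left, simp only: mult_ac)
  finally show ?thesis by (simp add: mult.commute)
qed

text \<open>The classical generating function \<open>(1 - X) powr - (a + 1)\<close> times
  \<open>exp (- t X / (1 - X))\<close>: the \<open>i\<close>-th power of \<open>X / (1 - X)\<close>
  raises \<open>a + 1\<close> to \<open>a + 1 + i\<close>.\<close>

lemma laguerre_fps:
  "of_real (laguerre N a t) = fps_nth (fps_neg_binomial 1 (of_real (a + 1))
     * (fps_exp (of_real (- t)) oo (fps_X * fps_neg_binomial 1 1))) N"
proof -
  have "fps_nth (fps_neg_binomial 1 (of_real (a + 1)) * (fps_X * fps_neg_binomial 1 1) ^ i) N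
      = of_real (pochhammer (a + 1 + real i) (N - i) / fact (N - i))" if "i \<le> N" for i
  proof -
    have "fps_neg_binomial 1 (of_real (a + 1)) * (fps_X * fps_neg_binomial 1 1) ^ i
        = fps_X ^ i * fps_neg_binomial 1 (of_real (a + 1 + real i))"
      by (simp add: power_mult_distrib fps_neg_binomial_power mult_ac add_ac flip: fps_neg_binomial_add)
    then show ?thesis
      using that by (simp add: fps_X_power_mult_nth fps_neg_binomial_def pochhammer_of_real del: of_real_add)
  qed
  then show ?thesis
    unfolding laguerre_def by (subst fps_mult_compose_nth) (simp_all add: fps_mult_nth)
qed

text \<open>Factor \<open>(1 - c X)^2 + e X^2\<close> as \<open>(1 - c X)^2\<close> times
  \<open>1 + e X^2 / (1 - c X)^2\<close> and expand the second factor to the power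
  \<open>- \<mu>\<close>. Each \<open>J\<close> costs \<open>X^2\<close>, so the sum stops at
  \<open>m div 2\<close>.\<close>

lemma gegenbauer_fps:
  "of_real (gegenbauer \<mu> e c m) = fps_nth (fps_neg_binomial (of_real c) (2 * of_real \<mu>)
     * (fps_neg_binomial (- of_real e) (of_real \<mu>) oo (fps_X\<^sup>2 * fps_neg_binomial (of_real c) 2))) m"
proof -
  let ?G = "fps_X\<^sup>2 * fps_neg_binomial (of_real c) 2" and ?A = "fps_neg_binomial (of_real c) (2 * of_real \<mu>)"
  have *: "?A * ?G ^ J = fps_X ^ (2 * J) * fps_neg_binomial (of_real c) (of_real (2 * \<mu> + 2 * real J))" for J
    by (simp add: power_mult_distrib fps_neg_binomial_power mult_ac add_ac flip: fps_neg_binomial_add power_mult)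
  have "fps_nth (?A * (fps_neg_binomial (- of_real e) (of_real \<mu>) oo ?G)) m
      = (\<Sum>J\<le>m. fps_nth (fps_neg_binomial (- of_real e) (of_real \<mu>)) J * fps_nth (?A * ?G ^ J) m)"
    by (rule fps_mult_compose_nth) simp
  also have "\<dots> = (\<Sum>J\<le>m div 2. fps_nth (fps_neg_binomial (- of_real e) (of_real \<mu>)) J * fps_nth (?A * ?G ^ J) m)"
    unfolding * by (rule sum.mono_neutral_right) (auto simp: fps_X_power_mult_nth)
  also have "\<dots> = of_real (gegenbauer \<mu> e c m)"
    unfolding * gegenbauer_def of_real_sum
  proof (rule sum.cong[OF refl])
    fix J assume "J \<in> {..m div 2}"
    then have "\<not> m < 2 * J" by auto
    then show "fps_nth (fps_neg_binomial (- of_real e) (of_real \<mu>)) J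
        * fps_nth (fps_X ^ (2 * J) * fps_neg_binomial (of_real c) (of_real (2 * \<mu> + 2 * real J))) m
      = of_real (pochhammer \<mu> J / fact J * (- e) ^ J
     * (c ^ (m - 2 * J) * (pochhammer (2 * \<mu> + 2 * real J) (m - 2 * J) / fact (m - 2 * J))))"
      by (simp add: fps_X_power_mult_nth fps_neg_binomial_def pochhammer_of_real del: of_real_add)
  qed
  finally show ?thesis ..
qed

section \<open>The generating function as a composition of series\<close>

definition gf_coeff :: "real \<Rightarrow> real \<Rightarrow> real \<Rightarrow> real \<Rightarrow> real \<Rightarrow> nat \<Rightarrow> real" where
  "gf_coeff s \<mu> e c t n = (\<Sum>m\<le>n. gegenbauer \<mu> e c m * laguerre (n - m) (2 * real m + s - 1) t)"

definition gf_fps :: "real \<Rightarrow> real \<Rightarrow> real \<Rightarrow> real \<Rightarrow> real \<Rightarrow> complex fps" where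
  "gf_fps s \<mu> e c t = Abs_fps (\<lambda>n. of_real (gf_coeff s \<mu> e c t n))"

text \<open>The Laguerre parameter grows by 2 with each \<open>m\<close>, so the \<open>m\<close>-th
  summand carries \<open>X ^ m\<close> times \<open>(1 - X) powr (- 2 m)\<close>, the
  \<open>m\<close>-th power of \<open>X / (1 - X)^2\<close>. This is the series substituted into the
  Gegenbauer generating function.\<close>

lemma gf_fps_eq:
  "gf_fps s \<mu> e c t = fps_neg_binomial 1 (of_real s) * (fps_exp (of_real (- t)) oo (fps_X * fps_neg_binomial 1 1))
     * ((fps_neg_binomial (of_real c) (2 * of_real \<mu>)
         * (fps_neg_binomial (- of_real e) (of_real \<mu>) oo (fps_X\<^sup>2 * fps_neg_binomial (of_real c) 2)))
       oo (fps_X * fps_neg_binomial 1 2))" (is "_ = ?A * ?E * (?H oo ?Y)")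
proof (rule fps_ext)
  fix n
  have "fps_nth (?A * ?E * (?H oo ?Y)) n = (\<Sum>m\<le>n. fps_nth ?H m * fps_nth (?A * ?E * ?Y ^ m) n)"
    by (rule fps_mult_compose_nth) simp
  also have "\<dots> = (\<Sum>m\<le>n. of_real (gegenbauer \<mu> e c m) * of_real (laguerre (n - m) (2 * real m + s - 1) t))"
  proof (rule sum.cong[OF refl])
    fix m assume "m \<in> {..n}"
    then have m: "\<not> n < m" by simp
    have "fps_neg_binomial 1 (of_real (2 * real m + s - 1 + 1)) = ?A * fps_neg_binomial 1 (of_nat m * 2)"
      by (simp add: add_ac mult.commute flip: fps_neg_binomial_add)
    then have eq: "?A * ?E * ?Y ^ m = fps_X ^ m * (fps_neg_binomial 1 (of_real (2 * real m + s - 1 + 1)) * ?E)"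
      by (simp only: power_mult_distrib fps_neg_binomial_power mult_ac)
    have "fps_nth (?A * ?E * ?Y ^ m) n
        = fps_nth (fps_neg_binomial 1 (of_real (2 * real m + s - 1 + 1)) * ?E) (n - m)"
      by (simp only: eq fps_X_power_mult_nth m if_False)
    then show "fps_nth ?H m * fps_nth (?A * ?E * ?Y ^ m) n
        = of_real (gegenbauer \<mu> e c m) * of_real (laguerre (n - m) (2 * real m + s - 1) t)"
      by (simp only: gegenbauer_fps laguerre_fps)
  qed
  finally show "fps_nth (gf_fps s \<mu> e c t) n = fps_nth (?A * ?E * (?H oo ?Y)) n"
    by (simp add: gf_fps_def gf_coeff_def)
qed

text \<open>Each factor keeps its own principal logarithm, as composition yields it; merging them is
  a separate question of branches.\<close>

lemma has_fps_expansion_gf: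
  defines "w \<equiv> \<lambda>z :: complex. z * exp (- 2 * Ln (1 - z))"
  shows "(\<lambda>z. exp (- of_real s * Ln (1 - z)) * exp (of_real (- t) * (z * exp (- Ln (1 - z))))
     * (exp (- (2 * of_real \<mu>) * Ln (1 - of_real c * w z))
        * exp (- of_real \<mu> * Ln (1 + of_real e * ((w z)\<^sup>2 * exp (- 2 * Ln (1 - of_real c * w z)))))))
    has_fps_expansion gf_fps s \<mu> e c t"
proof -
  note nb = has_fps_expansion_neg_binomial
  have w: "w has_fps_expansion (fps_X * fps_neg_binomial 1 2)"
    unfolding w_def using has_fps_expansion_mult[OF has_fps_expansion_fps_X nb[of 2 1]] by simp
  have v: "(\<lambda>w. w\<^sup>2 * exp (- 2 * Ln (1 - of_real c * w))) has_fps_expansion fps_X\<^sup>2 * fps_neg_binomial (of_real c) 2"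
    by (intro has_fps_expansion_mult has_fps_expansion_fps_X_power nb)
  have u: "(\<lambda>z. z * exp (- Ln (1 - z))) has_fps_expansion fps_X * fps_neg_binomial 1 1"
    using has_fps_expansion_mult[OF has_fps_expansion_fps_X nb[of 1 1]] by simp
  have E: "((\<lambda>z. exp (of_real (- t) * z)) \<circ> (\<lambda>z. z * exp (- Ln (1 - z)))) has_fps_expansion
      (fps_exp (of_real (- t)) oo (fps_X * fps_neg_binomial 1 1))"
    by (intro has_fps_expansion_compose has_fps_expansion_exp u) simp
  have H: "(\<lambda>w. exp (- (2 * of_real \<mu>) * Ln (1 - of_real c * w)) *
       ((\<lambda>v. exp (- of_real \<mu> * Ln (1 - (- of_real e) * v))) \<circ> (\<lambda>w. w\<^sup>2 * exp (- 2 * Ln (1 - of_real c * w)))) w)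
     has_fps_expansion (fps_neg_binomial (of_real c) (2 * of_real \<mu>)
         * (fps_neg_binomial (- of_real e) (of_real \<mu>) oo (fps_X\<^sup>2 * fps_neg_binomial (of_real c) 2)))"
    by (intro has_fps_expansion_mult has_fps_expansion_compose nb v) simp
  have "(\<lambda>z. exp (- of_real s * Ln (1 - 1 * z)) * ((\<lambda>z. exp (of_real (- t) * z)) \<circ> (\<lambda>z. z * exp (- Ln (1 - z)))) z
     * ((\<lambda>w. exp (- (2 * of_real \<mu>) * Ln (1 - of_real c * w)) *
       ((\<lambda>v. exp (- of_real \<mu> * Ln (1 - (- of_real e) * v))) \<circ> (\<lambda>w. w\<^sup>2 * exp (- 2 * Ln (1 - of_real c * w)))) w) \<circ> w) z)
    has_fps_expansion gf_fps s \<mu> e c t"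
    unfolding gf_fps_eq
    by (intro has_fps_expansion_mult has_fps_expansion_compose[OF H w] nb E) simp
  then show ?thesis by simp
qed

text \<open>With \<open>w = z / (1 - z)^2\<close> this is
  \<open>(1 - z)^4 * ((1 - c w)^2 + e w^2)\<close>. The type is left open to serve both on the real
  segment and in the complex disc.\<close>

definition gf_poly :: "real \<Rightarrow> real \<Rightarrow> 'a::real_normed_field \<Rightarrow> 'a" where
  "gf_poly e c z = ((1 - z)\<^sup>2 - z * of_real c)\<^sup>2 + z\<^sup>2 * of_real e"

text \<open>The difference is continuous, vanishes at 0 and takes values in the multiples of 2 pi i,
  so it is 0 as soon as its modulus is below pi.\<close>

lemma eq_if_exp_eq_near_0:
  fixes f g :: "complex \<Rightarrow> complex"
  assumes "isCont f 0" "isCont g 0" "f 0 = g 0" "\<forall>\<^sub>F z in nhds 0. exp (f z) = exp (g z)"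
  shows "\<forall>\<^sub>F z in nhds 0. f z = g z"
proof -
  have "isCont (\<lambda>z. f z - g z) 0" using assms by (intro continuous_intros)
  then have "((\<lambda>z. f z - g z) \<longlongrightarrow> 0) (nhds 0)"
    using assms(3) by (simp add: continuous_at tendsto_nhds_iff)
  then have "\<forall>\<^sub>F z in nhds 0. norm (f z - g z) < pi"
    by (auto dest!: tendstoD[OF _ pi_gt_zero])
  with assms(4) show ?thesis
  proof eventually_elim
    case (elim z)
    then have "exp (f z - g z) = 1" by (simp add: exp_diff)
    moreover have "\<bar>Im (f z - g z)\<bar> < pi" using elim(2) abs_Im_le_cmod le_less_trans by blast
    ultimately have "f z - g z = 0"
      by (metis Ln_1 Ln_exp abs_less_iff less_eq_real_def minus_less_iff)
    then show ?case by simp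
  qed
qed

text \<open>The quartic absorbs \<open>(1 - z)^4\<close> to the power \<open>- \<mu>\<close>, which
  is compensated by lowering \<open>s\<close> to \<open>s - 4 * \<mu>\<close>.\<close>

lemma gf_fps_near_0:
  "(\<lambda>z. exp (- of_real (s - 4 * \<mu>) * Ln (1 - z) - of_real t * z / (1 - z) - of_real \<mu> * Ln (gf_poly e c z)))
    has_fps_expansion gf_fps s \<mu> e c t"
proof -
  define w where "w z = z * exp (- 2 * Ln (1 - z))" for z :: complex
  define v where "v z = 1 + of_real e * ((w z)\<^sup>2 * exp (- 2 * Ln (1 - of_real c * w z)))" for z :: complex
  \<comment> \<open>A logarithm of the quartic assembled from its factors: \<open>(1 - z)^4\<close>,
    the square of \<open>1 - c w\<close>, and \<open>v\<close>.\<close>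
  define L where "L z = 4 * Ln (1 - z) + 2 * Ln (1 - of_real c * w z) + Ln (v z)" for z
  have w: "isCont w 0" "w 0 = 0" unfolding w_def by (auto intro!: continuous_intros)
  have cw: "isCont (\<lambda>z. 1 - of_real c * w z) 0" by (intro continuous_intros w)
  have v: "isCont v 0" "v 0 = 1" unfolding v_def by (auto intro!: continuous_intros w simp: w(2))
  have p: "isCont (gf_poly e c) (0::complex)" "gf_poly e c (0::complex) = 1"
    unfolding gf_poly_def by (auto intro!: continuous_intros)
  have nz: "\<forall>\<^sub>F z in nhds 0. f z \<noteq> 0" if "isCont f 0" "f 0 = 1" for f :: "complex \<Rightarrow> complex"
    using that by (intro tendsto_imp_eventually_ne[of _ 1]) (auto simp: continuous_at tendsto_nhds_iff)
  have ev: "\<forall>\<^sub>F z in nhds (0::complex). 1 - z \<noteq> 0" "\<forall>\<^sub>F z in nhds 0. 1 - of_real c * w z \<noteq> 0"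
      "\<forall>\<^sub>F z in nhds 0. v z \<noteq> 0" "\<forall>\<^sub>F z in nhds (0::complex). gf_poly e c z \<noteq> 0"
    by (rule nz; use cw v p w(2) in \<open>auto intro!: continuous_intros\<close>)+
  have "\<forall>\<^sub>F z in nhds 0. exp (L z) = exp (Ln (gf_poly e c z))"
    using ev
  proof eventually_elim
    case (elim z)
    define a where "a = 1 - of_real c * w z"
    have e2: "exp (2 * Ln y) = y\<^sup>2" if "y \<noteq> 0" for y :: complex
      using that exp_of_nat_mult[of 2 "Ln y"] by simp
    have e4: "exp (4 * Ln y) = y ^ 4" if "y \<noteq> 0" for y :: complex
      using that exp_of_nat_mult[of 4 "Ln y"] by simp
    have wz: "w z = z / (1 - z)\<^sup>2"
      using elim(1) by (simp add: w_def exp_minus e2 field_simps)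
    have a: "a = ((1 - z)\<^sup>2 - z * of_real c) / (1 - z)\<^sup>2" "a \<noteq> 0"
      using elim(1,2) unfolding a_def wz by (auto simp: divide_simps)
    have vz: "v z = 1 + of_real e * (w z)\<^sup>2 / a\<^sup>2"
    proof -
      have "exp (- 2 * Ln a) = 1 / a\<^sup>2" using e2[OF a(2)] by (simp add: exp_minus inverse_eq_divide)
      then show ?thesis unfolding v_def a_def[symmetric] by simp
    qed
    have "exp (L z) = (1 - z) ^ 4 * a\<^sup>2 * v z"
      unfolding L_def exp_add a_def[symmetric] using elim a(2) by (simp add: e2 e4)
    also have "\<dots> = (1 - z) ^ 4 * (a\<^sup>2 + of_real e * (w z)\<^sup>2)"
      unfolding vz using a(2) by (simp add: field_simps)
    also have "\<dots> = ((1 - z)\<^sup>2 * a)\<^sup>2 + of_real e * ((1 - z)\<^sup>2 * w z)\<^sup>2"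
      by (simp add: algebra_simps power2_eq_square power4_eq_xxxx)
    also have "\<dots> = gf_poly e c z"
      using elim(1) unfolding a(1) wz gf_poly_def by simp
    finally show ?case using elim(4) by simp
  qed
  note expL = this
  have "\<forall>\<^sub>F z in nhds 0. L z = Ln (gf_poly e c z)"
  proof (rule eq_if_exp_eq_near_0[OF _ _ _ expL])
    have Ln: "isCont (\<lambda>z. Ln (f z)) 0" if "isCont f 0" "f 0 = 1" for f :: "complex \<Rightarrow> complex"
      using that by (intro isCont_Ln') auto
    show "isCont (\<lambda>z. Ln (gf_poly e c z)) 0" by (rule Ln) (use p in auto)
    have "isCont (\<lambda>z::complex. Ln (1 - z)) 0" "isCont (\<lambda>z. Ln (1 - of_real c * w z)) 0" "isCont (\<lambda>z. Ln (v z)) 0"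
      by (rule Ln; use v w in \<open>auto intro!: continuous_intros\<close>)+
    then show "isCont L 0" unfolding L_def
      by (intro isCont_add isCont_mult continuous_const)
    show "L 0 = Ln (gf_poly e c (0::complex))" by (simp add: L_def w v p)
  qed
  then have "\<forall>\<^sub>F z in nhds 0. exp (- of_real s * Ln (1 - z)) * exp (of_real (- t) * (z * exp (- Ln (1 - z))))
     * (exp (- (2 * of_real \<mu>) * Ln (1 - of_real c * w z))
        * exp (- of_real \<mu> * Ln (1 + of_real e * ((w z)\<^sup>2 * exp (- 2 * Ln (1 - of_real c * w z))))))
     = exp (- of_real (s - 4 * \<mu>) * Ln (1 - z) - of_real t * z / (1 - z) - of_real \<mu> * Ln (gf_poly e c z))"
    using ev(1)
  proof eventually_elim
    case (elim z)
    have "z * exp (- Ln (1 - z)) = z / (1 - z)"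
      using elim(2) by (simp add: exp_minus field_simps)
    then show ?case
      unfolding v_def[symmetric] exp_add[symmetric] elim(1)[symmetric] L_def
      by (simp add: algebra_simps)
  qed
  then show ?thesis
    using has_fps_expansion_gf[of s t \<mu> c e, folded w_def] by (subst (asm) has_fps_expansion_cong) auto
qed

section \<open>Convergence and boundary values\<close>

lemma abel_limit:
  fixes a :: "nat \<Rightarrow> real"
  assumes "summable a"
  shows "((\<lambda>x. \<Sum>n. a n * x ^ n) \<longlongrightarrow> suminf a) (at_left 1)"
proof -
  \<comment> \<open>The tails of the series. Writing \<open>a n = R n - R (Suc n)\<close> is the
    summation by parts that leads to \<open>suminf a - (1 - x) * V x\<close>.\<close>
  define R where "R n = suminf a - (\<Sum>k<n. a k)" for n
  have R0: "R \<longlonglongrightarrow> 0"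
    unfolding R_def using summable_LIMSEQ[OF assms] by (auto intro!: tendsto_eq_intros)
  then have RS0: "(\<lambda>n. R (Suc n)) \<longlonglongrightarrow> 0" by (rule LIMSEQ_Suc)
  have aR: "a n = R n - R (Suc n)" for n by (simp add: R_def)
  obtain B where B: "\<And>n. \<bar>R n\<bar> \<le> B"
    using convergent_imp_Bseq[OF convergentI[OF R0]] unfolding Bseq_def by auto
  define V where "V x = (\<Sum>n. R (Suc n) * x ^ n)" for x
  have sm: "summable (\<lambda>n. R (f n) * x ^ n)" "summable (\<lambda>n. \<bar>R (f n) * x ^ n\<bar>)" if "0 < x" "x < 1" for x f
  proof -
    have *: "norm \<bar>R (f n) * x ^ n\<bar> \<le> B * x ^ n" for n
      using mult_right_mono[OF B[of "f n"], of "x ^ n"] that by (simp add: abs_mult)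
    have "summable (\<lambda>n. B * x ^ n)" using that by (intro summable_mult summable_geometric) auto
    then show "summable (\<lambda>n. \<bar>R (f n) * x ^ n\<bar>)"
      by (rule summable_comparison_test') (rule *)
    then show "summable (\<lambda>n. R (f n) * x ^ n)" by (rule summable_rabs_cancel)
  qed
  have eq: "(\<Sum>n. a n * x ^ n) = suminf a - (1 - x) * V x" if x: "0 < x" "x < 1" for x
  proof -
    have "(\<Sum>n. a n * x ^ n) = (\<Sum>n. R n * x ^ n) - V x"
      unfolding V_def aR left_diff_distrib
      by (rule suminf_diff[symmetric]) (use sm[OF x, of "\<lambda>n. n"] sm[OF x, of Suc] in auto)
    also have "(\<Sum>n. R n * x ^ n) = R 0 + (\<Sum>n. R (Suc n) * x ^ Suc n)"
      using suminf_split_head[OF sm(1)[OF x, of "\<lambda>n. n"]] by simp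
    also have "(\<Sum>n. R (Suc n) * x ^ Suc n) = x * V x"
      unfolding V_def using suminf_mult[OF sm(1)[OF x, of Suc], of x] by (simp add: mult_ac)
    finally show ?thesis by (simp add: R_def algebra_simps)
  qed
  \<comment> \<open>The first \<open>N\<close> terms contribute at most \<open>(1 - x) * K\<close>,
    which tends to 0. Beyond \<open>N\<close> the tails are below \<open>\<epsilon> / 2\<close>, and
    \<open>1 - x\<close> cancels the geometric sum.\<close>
  have V0: "((\<lambda>x. (1 - x) * V x) \<longlongrightarrow> 0) (at_left 1)"
  proof (rule tendstoI)
    fix \<epsilon> :: real assume "\<epsilon> > 0"
    then have \<epsilon>: "\<epsilon> / 2 > 0" by simp
    obtain N where N: "\<And>n. n \<ge> N \<Longrightarrow> \<bar>R (Suc n)\<bar> < \<epsilon> / 2"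
      using LIMSEQ_D[OF RS0 \<epsilon>] by auto
    define K where "K = (\<Sum>n<N. \<bar>R (Suc n)\<bar>)"
    have "((\<lambda>x. (1 - x) * K) \<longlongrightarrow> 0) (at_left 1)" by (auto intro!: tendsto_eq_intros)
    then have "\<forall>\<^sub>F x in at_left 1. (1 - x) * K < \<epsilon> / 2"
      using \<epsilon> by (rule order_tendstoD)
    moreover have "\<forall>\<^sub>F x in at_left (1::real). x \<in> {0<..<1}"
      by (rule eventually_at_leftI[of 0]) auto
    ultimately show "\<forall>\<^sub>F x in at_left 1. dist ((1 - x) * V x) 0 < \<epsilon>"
    proof eventually_elim
      case (elim x)
      then have x: "0 < x" "x < 1" by auto
      have s1: "(\<lambda>n. if n \<in> {..<N} then \<bar>R (Suc n)\<bar> else 0) sums K"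
        unfolding K_def by (rule sums_If_finite_set) simp
      have s2: "(\<lambda>n. \<epsilon> / 2 * x ^ n) sums (\<epsilon> / 2 * (1 / (1 - x)))"
        using x by (intro sums_mult geometric_sums) auto
      have "\<bar>V x\<bar> \<le> (\<Sum>n. \<bar>R (Suc n) * x ^ n\<bar>)"
        unfolding V_def by (rule summable_rabs) (rule sm(2)[OF x])
      also have "\<dots> \<le> (\<Sum>n. (if n \<in> {..<N} then \<bar>R (Suc n)\<bar> else 0) + \<epsilon> / 2 * x ^ n)"
      proof (rule suminf_le)
        fix n
        have "x ^ n \<le> 1" using x by (simp add: power_le_one)
        then have "\<bar>R (Suc n)\<bar> * x ^ n \<le> \<bar>R (Suc n)\<bar>" by (simp add: mult_left_le)
        moreover have "\<bar>R (Suc n)\<bar> * x ^ n \<le> \<epsilon> / 2 * x ^ n" if "n \<ge> N"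
          using N[OF that] x by (intro mult_right_mono) auto
        ultimately show "\<bar>R (Suc n) * x ^ n\<bar> \<le> (if n \<in> {..<N} then \<bar>R (Suc n)\<bar> else 0) + \<epsilon> / 2 * x ^ n"
          using x \<epsilon> by (auto simp: abs_mult intro: add_increasing2)
      qed (use sm(2)[OF x] sums_summable[OF sums_add[OF s1 s2]] in auto)
      also have "\<dots> = K + \<epsilon> / 2 * (1 / (1 - x))"
        using sums_add[OF s1 s2] by (rule sums_unique[symmetric])
      finally have "(1 - x) * \<bar>V x\<bar> \<le> (1 - x) * (K + \<epsilon> / 2 * (1 / (1 - x)))"
        using x by (intro mult_left_mono) auto
      also have "\<dots> = (1 - x) * K + \<epsilon> / 2" using x by (simp add: field_simps)
      also have "\<dots> < \<epsilon>" using elim(1) by simp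
      finally show ?case using x by (simp add: dist_real_def abs_mult)
    qed
  qed
  have "((\<lambda>x. suminf a - (1 - x) * V x) \<longlongrightarrow> suminf a - 0) (at_left 1)"
    by (intro tendsto_intros V0)
  moreover have "\<forall>\<^sub>F x in at_left (1::real). x \<in> {0<..<1}"
    by (rule eventually_at_leftI[of 0]) auto
  then have "\<forall>\<^sub>F x in at_left (1::real). suminf a - (1 - x) * V x = (\<Sum>n. a n * x ^ n)"
    by eventually_elim (auto simp: eq)
  ultimately show ?thesis by (simp add: tendsto_cong)
qed

lemma abel_limit_at:
  fixes a :: "nat \<Rightarrow> real"
  assumes "r > 0" and "summable (\<lambda>n. a n * r ^ n)"
  shows "((\<lambda>x. \<Sum>n. a n * x ^ n) \<longlongrightarrow> (\<Sum>n. a n * r ^ n)) (at_left r)"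
proof -
  have "filterlim (\<lambda>x. x / r) (at_left 1) (at_left r)"
  proof (rule tendsto_imp_filterlim_at_left)
    show "((\<lambda>x. x / r) \<longlongrightarrow> 1) (at_left r)"
      using assms(1) by (auto intro!: tendsto_eq_intros)
    show "\<forall>\<^sub>F x in at_left r. x / r < 1"
      using assms(1) by (intro eventually_at_leftI[of 0]) auto
  qed
  from filterlim_compose[OF abel_limit[OF assms(2)] this] show ?thesis
    using assms(1) by (simp add: power_divide)
qed

text \<open>For \<open>\<mu> = 0\<close> the zeros of the quartic play no role; replacing it by 1 avoids a case distinction.\<close>

definition gf_base :: "real \<Rightarrow> real \<Rightarrow> real \<Rightarrow> 'a::real_normed_field \<Rightarrow> 'a" where
  "gf_base \<mu> e c z = (if \<mu> = 0 then 1 else gf_poly e c z)"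

lemma gf_base_near_0:
  "(\<lambda>z. exp (- of_real (s - 4 * \<mu>) * Ln (1 - z) - of_real t * z / (1 - z) - of_real \<mu> * Ln (gf_base \<mu> e c z)))
    has_fps_expansion gf_fps s \<mu> e c t"
  using gf_fps_near_0[of s \<mu> t e c] by (cases "\<mu> = 0") (simp_all add: gf_base_def)

lemma gf_base_0 [simp]: "gf_base \<mu> e c 0 = 1"
  by (simp add: gf_base_def gf_poly_def)

lemma holomorphic_gf_base [holomorphic_intros]: "gf_base \<mu> e c holomorphic_on S"
  unfolding gf_base_def gf_poly_def by (cases "\<mu> = 0") (auto intro!: holomorphic_intros)

lemma continuous_on_gf_base: "continuous_on S (gf_base \<mu> e c)"
  unfolding gf_base_def gf_poly_def by (cases "\<mu> = 0") (auto intro!: continuous_intros)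

lemma gf_base_of_real: "gf_base \<mu> e c (of_real x :: 'a::real_normed_field) = of_real (gf_base \<mu> e c x)"
  by (simp add: gf_base_def gf_poly_def)

text \<open>Compactness of the closed ball. The larger radius is what puts \<open>r\<close> strictly
  inside a disc of holomorphy; \<open>R\<close> caps it.\<close>

lemma ball_subset_open_extend:
  fixes U :: "'a::euclidean_space set"
  assumes "open U" and "cball 0 r \<subseteq> U" and "0 \<le> r" and "r < R"
  obtains r' where "r < r'" "r' < R" "ball 0 r' \<subseteq> U"
proof -
  obtain \<epsilon> where \<epsilon>: "\<epsilon> > 0" "(\<Union>x\<in>cball 0 r. ball x \<epsilon>) \<subseteq> U"
    using compact_subset_open_imp_ball_epsilon_subset[OF compact_cball assms(1,2)] by metis
  define r' where "r' = min (r + \<epsilon>) ((r + R) / 2)"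
  have "ball 0 r' \<subseteq> U"
  proof
    fix z :: 'a assume z: "z \<in> ball 0 r'"
    show "z \<in> U"
    proof (cases "norm z \<le> r")
      case False
      \<comment> \<open>The radial projection of \<open>z\<close> to the sphere of radius
        \<open>r\<close>, at distance \<open>norm z - r < \<epsilon>\<close>.\<close>
      define y where "y = (r / norm z) *\<^sub>R z"
      have "norm z > 0" using False assms(3) by linarith
      then have y: "norm y = r" using assms(3) by (simp add: y_def)
      have "z - y = (1 - r / norm z) *\<^sub>R z" by (simp add: y_def scaleR_left_diff_distrib)
      then have "norm (z - y) = \<bar>1 - r / norm z\<bar> * norm z" by (simp only: norm_scaleR)
      moreover have "\<bar>1 - r / norm z\<bar> = 1 - r / norm z"
        using False \<open>norm z > 0\<close> by simp
      ultimately have "norm (z - y) = norm z - r"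
        using \<open>norm z > 0\<close> by (simp add: left_diff_distrib)
      then have "z \<in> ball y \<epsilon>"
        using z \<open>norm z > 0\<close> by (simp add: dist_norm norm_minus_commute r'_def field_simps)
      moreover have "y \<in> cball 0 r" using y by simp
      ultimately have "z \<in> (\<Union>x\<in>cball 0 r. ball x \<epsilon>)" by blast
      then show ?thesis using \<epsilon>(2) by blast
    qed (use assms(2) in auto)
  qed
  moreover have "r < r'" "r' < R" using assms(4) \<epsilon>(1) by (auto simp: r'_def min_less_iff_disj)
  ultimately show ?thesis using that by blast
qed

text \<open>On a slightly larger disc the zero-free base has a holomorphic logarithm, so the
  function near 0 extends there and its Taylor series converges beyond \<open>r\<close>. Keeping
  \<open>r' < 1\<close> avoids the singularity at 1.\<close>

lemma gf_summable:
  assumes r: "0 < r" "r < 1"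
    and nz: "\<And>z :: complex. norm z \<le> r \<Longrightarrow> gf_base \<mu> e c z \<noteq> 0"
  shows "summable (\<lambda>n. gf_coeff s \<mu> e c t n * r ^ n)"
proof -
  have "open {z :: complex. gf_base \<mu> e c z \<noteq> 0}"
    by (intro open_Collect_neq continuous_on_gf_base continuous_intros)
  moreover have "cball 0 r \<subseteq> {z :: complex. gf_base \<mu> e c z \<noteq> 0}" using nz by auto
  ultimately obtain r' where r': "r < r'" "r' < 1" "ball 0 r' \<subseteq> {z :: complex. gf_base \<mu> e c z \<noteq> 0}"
    by (rule ball_subset_open_extend) (use r in auto)
  obtain L where L: "L holomorphic_on ball 0 r'" "\<And>z. z \<in> ball 0 r' \<Longrightarrow> exp (L z) = gf_base \<mu> e c z"
  proof (rule holomorphic_logarithm_exists[OF convex_ball open_ball holomorphic_gf_base])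
    show "gf_base \<mu> e c z \<noteq> 0" if "z \<in> ball 0 r'" for z :: complex using r'(3) that by blast
    show "(0 :: complex) \<in> ball 0 r'" using r r' by simp
  qed (rule that)
  have Lc: "isCont L 0"
    using L(1) r r' by (meson centre_in_ball continuous_on_eq_continuous_at dual_order.strict_trans holomorphic_on_imp_continuous_on open_ball)
  have L0: "exp (L 0) = 1" using L(2)[of 0] r r' by simp
  have inball: "\<forall>\<^sub>F z in nhds 0. z \<in> ball (0::complex) r'"
    by (rule eventually_nhds_in_open) (use r r' in auto)
  \<comment> \<open>\<open>L 0\<close> is only known to be a multiple of 2 pi i; subtracting it
    selects the branch that agrees with \<open>Ln\<close>.\<close>
  have "\<forall>\<^sub>F z in nhds 0. L z - L 0 = Ln (gf_base \<mu> e c z)"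
  proof (rule eq_if_exp_eq_near_0)
    show "isCont (\<lambda>z. L z - L 0) 0" by (intro continuous_intros Lc)
    have "isCont (gf_base \<mu> e c) (0 :: complex)"
      using continuous_on_gf_base[of "UNIV :: complex set" \<mu> e c] by (simp add: continuous_on_eq_continuous_at)
    then show "isCont (\<lambda>z. Ln (gf_base \<mu> e c z)) (0 :: complex)" by (intro isCont_Ln') auto
    show "\<forall>\<^sub>F z in nhds 0. exp (L z - L 0) = exp (Ln (gf_base \<mu> e c z))"
      using inball by eventually_elim (use L L0 r' in \<open>auto simp: exp_diff\<close>)
  qed simp
  then have "\<forall>\<^sub>F z in nhds 0. exp (- of_real (s - 4 * \<mu>) * Ln (1 - z) - of_real t * z / (1 - z) - of_real \<mu> * (L z - L 0))
      = exp (- of_real (s - 4 * \<mu>) * Ln (1 - z) - of_real t * z / (1 - z) - of_real \<mu> * Ln (gf_base \<mu> e c z))"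
    by eventually_elim simp
  then have ex: "(\<lambda>z. exp (- of_real (s - 4 * \<mu>) * Ln (1 - z) - of_real t * z / (1 - z) - of_real \<mu> * (L z - L 0)))
      has_fps_expansion gf_fps s \<mu> e c t"
    using gf_base_near_0 by (subst has_fps_expansion_cong) auto
  have dom: "1 - z \<notin> \<real>\<^sub>\<le>\<^sub>0" "1 - z \<noteq> 0" if "z \<in> ball 0 r'" for z :: complex
  proof -
    have "Re z < 1" using that r' complex_Re_le_cmod[of z] by auto
    then show "1 - z \<notin> \<real>\<^sub>\<le>\<^sub>0" "1 - z \<noteq> 0" by (auto simp: complex_nonpos_Reals_iff)
  qed
  have "(\<lambda>z. exp (- of_real (s - 4 * \<mu>) * Ln (1 - z) - of_real t * z / (1 - z) - of_real \<mu> * (L z - L 0)))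
      holomorphic_on eball 0 (ereal r')"
  proof -
    have "(\<lambda>z. Ln (1 - z)) holomorphic_on ball 0 r'"
      by (intro holomorphic_on_Ln'[OF dom(1)] holomorphic_on_diff holomorphic_on_const holomorphic_on_ident)
    moreover have "(\<lambda>z. of_real t * z / (1 - z)) holomorphic_on ball 0 r'"
      by (intro holomorphic_on_divide holomorphic_on_mult holomorphic_on_diff holomorphic_on_const holomorphic_on_ident)
        (use dom in auto)
    ultimately show ?thesis unfolding eball_ereal
      by (intro holomorphic_on_exp' holomorphic_on_diff holomorphic_on_mult holomorphic_on_const L(1))
  qed
  with ex have "fps_conv_radius (gf_fps s \<mu> e c t) \<ge> ereal r'"
    by (rule holomorphic_on_imp_fps_conv_radius_ge)
  moreover have "ereal (norm (of_real r :: complex)) < ereal r'" using r r' by simp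
  ultimately have "summable (\<lambda>n. fps_nth (gf_fps s \<mu> e c t) n * of_real r ^ n)"
    by (intro summable_fps) (rule less_le_trans)
  then have "summable (\<lambda>n. complex_of_real (gf_coeff s \<mu> e c t n * r ^ n))"
    by (simp add: gf_fps_def)
  then show ?thesis by (simp only: summable_complex_of_real)
qed

text \<open>Convergence at \<open>r\<close> makes the series holomorphic on the disc of radius
  \<open>r\<close>. The closed form is holomorphic where the base avoids the cut of
  \<open>Ln\<close>, and the identity theorem on the component of 0 carries the equality from near 0
  to \<open>x\<close>.\<close>

lemma gf_value_before_zero:
  assumes r: "0 < r" "r < 1" and sm: "summable (\<lambda>n. gf_coeff s \<mu> e c t n * r ^ n)"
    and x: "0 \<le> x" "x < r" and pos: "\<And>y. 0 \<le> y \<Longrightarrow> y \<le> x \<Longrightarrow> gf_base \<mu> e c y > 0"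
  shows "(\<Sum>n. gf_coeff s \<mu> e c t n * x ^ n)
    = exp (- (s - 4 * \<mu>) * ln (1 - x) - t * x / (1 - x)) * gf_base \<mu> e c x powr (- \<mu>)"
proof -
  let ?F = "gf_fps s \<mu> e c t"
  define f where "f z = exp (- of_real (s - 4 * \<mu>) * Ln (1 - z) - of_real t * z / (1 - z) - of_real \<mu> * Ln (gf_base \<mu> e c z))"
    for z :: complex
  have "summable (\<lambda>n. fps_nth ?F n * of_real r ^ n)"
    using summable_of_real[OF sm, where ?'a = complex] by (simp add: gf_fps_def)
  then have "fps_conv_radius ?F \<ge> norm (of_real r :: complex)"
    unfolding fps_conv_radius_def by (rule conv_radius_geI)
  then have rad: "fps_conv_radius ?F \<ge> ereal r" using r by simp
  define V where "V = ball 0 r \<inter> gf_base \<mu> e c -` (- \<real>\<^sub>\<le>\<^sub>0 :: complex set)"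
  have "open V" unfolding V_def
    by (intro open_Int open_ball open_vimage continuous_on_gf_base open_Compl closed_nonpos_Reals_complex)
  define C where "C = connected_component_set V 0"
  have V0: "0 \<in> V" using r by (simp add: V_def)
  have C: "open C" "connected C" "0 \<in> C" "C \<subseteq> V"
    unfolding C_def using \<open>open V\<close> V0
    by (auto simp: open_connected_component connected_component_refl connected_component_subset)
  \<comment> \<open>Positivity of the base keeps the segment off the cut, so it is a connected
    subset of \<open>V\<close> through 0.\<close>
  have seg: "closed_segment 0 (of_real x) \<subseteq> V"
  proof
    fix z :: complex assume "z \<in> closed_segment 0 (of_real x)"
    then obtain u where u: "0 \<le> u" "u \<le> 1" "z = of_real (u * x)"
      by (auto simp: in_segment scaleR_conv_of_real)
    have ux: "0 \<le> u * x" "u * x \<le> x" using u x by (auto simp: mult_left_le_one_le)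
    then have "norm z < r" unfolding u(3) norm_of_real using x by auto
    moreover have "gf_base \<mu> e c z \<notin> \<real>\<^sub>\<le>\<^sub>0"
      using pos[OF ux] unfolding u(3) gf_base_of_real by (simp add: complex_nonpos_Reals_iff)
    ultimately show "z \<in> V" by (simp add: V_def)
  qed
  have "closed_segment 0 (of_real x) \<subseteq> C"
    unfolding C_def by (rule connected_component_maximal) (use seg in auto)
  then have xC: "of_real x \<in> C" by auto
  have dom: "1 - z \<notin> \<real>\<^sub>\<le>\<^sub>0" "1 - z \<noteq> 0" "gf_base \<mu> e c z \<notin> \<real>\<^sub>\<le>\<^sub>0" "norm z < r" if "z \<in> C" for z :: complex
  proof -
    have "z \<in> V" using that C by blast
    then have "norm z < r" and g: "gf_base \<mu> e c z \<notin> \<real>\<^sub>\<le>\<^sub>0" by (auto simp: V_def)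
    then have "Re z < 1" using r complex_Re_le_cmod[of z] by auto
    then show "1 - z \<notin> \<real>\<^sub>\<le>\<^sub>0" "1 - z \<noteq> 0" by (auto simp: complex_nonpos_Reals_iff)
    show "gf_base \<mu> e c z \<notin> \<real>\<^sub>\<le>\<^sub>0" "norm z < r" by fact+
  qed
  have "f has_fps_expansion ?F"
    unfolding f_def by (rule gf_base_near_0)
  then obtain W where W: "open W" "0 \<in> W" "\<And>z. z \<in> W \<Longrightarrow> eval_fps ?F z = f z"
    unfolding has_fps_expansion_def eventually_nhds by blast
  have "eval_fps ?F (of_real x) = f (of_real x)"
  proof (rule analytic_continuation_open[where s = "W \<inter> C" and s' = C and f = "eval_fps ?F" and g = f])
    show "eval_fps ?F holomorphic_on C"
    proof (intro holomorphic_intros subsetI)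
      fix z assume "z \<in> C"
      then have "ereal (norm z) < ereal r" using dom by simp
      then have "ereal (norm z) < fps_conv_radius ?F" using rad by (rule less_le_trans)
      then show "z \<in> eball 0 (fps_conv_radius ?F)" by simp
    qed
    have "(\<lambda>z. Ln (1 - z)) holomorphic_on C" "(\<lambda>z. Ln (gf_base \<mu> e c z)) holomorphic_on C"
      by (rule holomorphic_on_Ln', erule dom, intro holomorphic_on_diff holomorphic_on_const holomorphic_on_ident)
        (rule holomorphic_on_Ln', erule dom, rule holomorphic_gf_base)
    moreover have "(\<lambda>z. of_real t * z / (1 - z)) holomorphic_on C"
      by (intro holomorphic_on_divide holomorphic_on_mult holomorphic_on_diff holomorphic_on_const holomorphic_on_ident)
        (use dom in auto)
    ultimately show "f holomorphic_on C" unfolding f_def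
      by (intro holomorphic_on_exp' holomorphic_on_diff holomorphic_on_mult holomorphic_on_const)
  qed (use W C xC in auto)
  moreover have "eval_fps ?F (of_real x) = of_real (\<Sum>n. gf_coeff s \<mu> e c t n * x ^ n)"
  proof -
    have "summable (\<lambda>n. gf_coeff s \<mu> e c t n * x ^ n)"
      by (rule powser_inside[OF sm]) (use x in auto)
    from suminf_of_real[OF this, where ?'a = complex] show ?thesis
      by (simp add: eval_fps_def gf_fps_def)
  qed
  moreover have "f (of_real x) = of_real (exp (- (s - 4 * \<mu>) * ln (1 - x) - t * x / (1 - x)) * gf_base \<mu> e c x powr (- \<mu>))"
  proof -
    have g: "gf_base \<mu> e c x > 0" using pos[of x] x by simp
    have "Ln (1 - of_real x) = of_real (ln (1 - x))"
      using Ln_of_real[of "1 - x"] x r by simp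
    moreover have "Ln (gf_base \<mu> e c (of_real x)) = of_real (ln (gf_base \<mu> e c x))"
      unfolding gf_base_of_real using g by (rule Ln_of_real)
    ultimately have "f (of_real x) = exp (of_real (- (s - 4 * \<mu>) * ln (1 - x) - t * x / (1 - x) - \<mu> * ln (gf_base \<mu> e c x)))"
      unfolding f_def by simp
    also have "\<dots> = of_real (exp (- (s - 4 * \<mu>) * ln (1 - x) - t * x / (1 - x) - \<mu> * ln (gf_base \<mu> e c x)))"
      by (rule exp_of_real)
    also have "exp (- (s - 4 * \<mu>) * ln (1 - x) - t * x / (1 - x) - \<mu> * ln (gf_base \<mu> e c x))
        = exp (- (s - 4 * \<mu>) * ln (1 - x) - t * x / (1 - x)) * gf_base \<mu> e c x powr (- \<mu>)"
      using g by (simp add: powr_def flip: exp_add)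
    finally show ?thesis .
  qed
  ultimately show ?thesis by (metis of_real_eq_iff)
qed


text \<open>The base \<open>P\<close> is nonnegative on the reals, so the formula for
  \<open>\<phi>\<close> is available up to its first zero. None lies before \<open>r\<close>, and
  left limits settle the value at \<open>r\<close>, whether or not \<open>P r = 0\<close>.\<close>

lemma gf_sum:
  assumes "\<mu> > - 1/2" and e: "e \<ge> 0" and r: "0 < r" "r < 1"
    and sm: "summable (\<lambda>n. gf_coeff s \<mu> e c t n * r ^ n)"
  shows "(\<Sum>n. gf_coeff s \<mu> e c t n * r ^ n)
    = exp (- (s - 4 * \<mu>) * ln (1 - r) - t * r / (1 - r)) / rpow (gf_poly e c r) \<mu>"
proof -
  define \<phi> where "\<phi> x = (\<Sum>n. gf_coeff s \<mu> e c t n * x ^ n)" for x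
  define K where "K x = exp (- (s - 4 * \<mu>) * ln (1 - x) - t * x / (1 - x))" for x :: real
  define P :: "real \<Rightarrow> real" where "P = gf_base \<mu> e c"
  have K_pos: "K x > 0" for x by (simp add: K_def)
  have P_nonneg: "P x \<ge> 0" for x
    using e by (simp add: P_def gf_base_def gf_poly_def)
  have K_lim: "(K \<longlongrightarrow> K x) (at_left x)" if "x < 1" for x
    unfolding K_def using that by (auto intro!: tendsto_eq_intros)
  have P_lim: "(P \<longlongrightarrow> P x) (at_left x)" for x
    using continuous_on_gf_base[of "UNIV :: real set" \<mu> e c] filterlim_at_split
    unfolding P_def continuous_on_eq_continuous_at[OF open_UNIV] isCont_def by blast
  have \<phi>_lim: "(\<phi> \<longlongrightarrow> \<phi> x) (at_left x)" if "0 < x" "x \<le> r" for x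
    unfolding \<phi>_def
  proof (rule abel_limit_at)
    show "summable (\<lambda>n. gf_coeff s \<mu> e c t n * x ^ n)"
    proof (cases "x = r")
      case False
      then show ?thesis by (intro powser_inside[OF sm]) (use that in auto)
    qed (use sm in simp)
  qed fact
  have near: "\<forall>\<^sub>F x in at_left x0. x \<in> {0<..<x0}" if "0 < x0" for x0 :: real
    by (rule eventually_at_leftI[of 0]) (use that in auto)
  have \<phi>_eq: "\<phi> x = K x * P x powr (- \<mu>)" if "0 \<le> x" "x < x0" "x0 \<le> r" "\<And>y. 0 \<le> y \<Longrightarrow> y < x0 \<Longrightarrow> P y > 0" for x x0
    unfolding \<phi>_def K_def P_def
    by (rule gf_value_before_zero[OF r sm]) (use that in \<open>auto simp: P_def\<close>)
  \<comment> \<open>For \<open>\<mu> > 0\<close> the product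
    \<open>\<phi> x * P x powr \<mu> = K x\<close> would tend both to 0 and to
    \<open>K x0 > 0\<close>. For \<open>\<mu> < 0\<close> the formula itself tends to 0. For
    \<open>\<mu> = 0\<close> the base is 1 and has no zero.\<close>
  have \<phi>_zero: "\<mu> < 0 \<and> \<phi> x0 = 0"
    if x0: "0 < x0" "x0 \<le> r" "\<And>y. 0 \<le> y \<Longrightarrow> y < x0 \<Longrightarrow> P y > 0" "P x0 = 0" for x0
  proof -
    have "\<mu> \<noteq> 0" using x0(4) by (auto simp: P_def gf_base_def)
    have pow: "((\<lambda>x. P x powr a) \<longlongrightarrow> 0) (at_left x0)" if "a > 0" for a
      using tendsto_powr'[OF P_lim[of x0] tendsto_const[of a]] that x0(4) P_nonneg by auto
    have nontriv: "at_left x0 \<noteq> bot" by simp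
    show ?thesis
    proof (cases "\<mu> > 0")
      case True
      have "((\<lambda>x. \<phi> x * P x powr \<mu>) \<longlongrightarrow> \<phi> x0 * 0) (at_left x0)"
        by (intro tendsto_mult \<phi>_lim pow x0 True)
      moreover have "\<forall>\<^sub>F x in at_left x0. \<phi> x * P x powr \<mu> = K x"
        using near[OF x0(1)]
      proof eventually_elim
        case (elim x)
        then have "P x > 0" using x0(3) by simp
        then have "P x powr (- \<mu>) * P x powr \<mu> = 1" by (simp flip: powr_add)
        moreover have "\<phi> x = K x * P x powr (- \<mu>)" using \<phi>_eq[of x x0] elim x0 by simp
        ultimately show ?case by simp
      qed
      ultimately have "(K \<longlongrightarrow> 0) (at_left x0)" by (simp add: tendsto_cong)
      moreover have "(K \<longlongrightarrow> K x0) (at_left x0)" by (rule K_lim) (use x0 r in simp)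
      ultimately have "K x0 = 0" using tendsto_unique[OF nontriv] by blast
      then show ?thesis using K_pos[of x0] by simp
    next
      case False
      with \<open>\<mu> \<noteq> 0\<close> have "\<mu> < 0" by simp
      have "((\<lambda>x. K x * P x powr (- \<mu>)) \<longlongrightarrow> K x0 * 0) (at_left x0)"
        by (intro tendsto_mult K_lim pow) (use x0 r \<open>\<mu> < 0\<close> in auto)
      moreover have "\<forall>\<^sub>F x in at_left x0. K x * P x powr (- \<mu>) = \<phi> x"
        using near[OF x0(1)] by eventually_elim (use \<phi>_eq[of _ x0] x0 in auto)
      ultimately have "(\<phi> \<longlongrightarrow> 0) (at_left x0)" by (simp add: tendsto_cong)
      then have "\<phi> x0 = 0" using tendsto_unique[OF nontriv \<phi>_lim] x0 by blast
      with \<open>\<mu> < 0\<close> show ?thesis by simp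
    qed
  qed
  have no_zero: "P y > 0" if y: "0 \<le> y" "y < r" for y
  proof (rule ccontr)
    assume "\<not> P y > 0"
    then have "P y = 0" using P_nonneg[of y] by simp
    define Z where "Z = {0..r} \<inter> P -` {0}"
    have "compact Z" unfolding Z_def P_def
      by (intro closed_Int_compact[of _ "{0..r}", unfolded Int_commute[of _ "{0..r}"]] closed_vimage continuous_on_gf_base) auto
    moreover have "y \<in> Z" using \<open>P y = 0\<close> y by (simp add: Z_def)
    ultimately obtain x0 where x0: "x0 \<in> Z" "\<And>z. z \<in> Z \<Longrightarrow> x0 \<le> z"
      using compact_attains_inf[of Z] by blast
    have x0r: "0 \<le> x0" "x0 < r" "P x0 = 0" using x0(1) x0(2)[OF \<open>y \<in> Z\<close>] y by (auto simp: Z_def)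
    have "x0 \<noteq> 0" using x0r(3) by (auto simp: P_def)
    then have x0_pos: "x0 > 0" using x0r by simp
    have before: "P z > 0" if "0 \<le> z" "z < x0" for z
    proof (rule ccontr)
      assume "\<not> P z > 0"
      then have "z \<in> Z" using P_nonneg[of z] that x0r by (auto simp: Z_def)
      then show False using x0(2)[of z] that by simp
    qed
    have \<mu>: "\<mu> < 0" and \<phi>0: "\<phi> x0 = 0" using \<phi>_zero[OF x0_pos _ before x0r(3)] x0r by auto
    \<comment> \<open>Both squares vanish, so \<open>e = 0\<close> and \<open>x0\<close> is a root
      of the inner quadratic. Its roots have product 1, so the other root is
      \<open>1 / x0\<close>.\<close>
    have "((1 - x0)\<^sup>2 - x0 * c)\<^sup>2 + x0\<^sup>2 * e = 0"
      using x0r(3) \<mu> by (simp add: P_def gf_base_def gf_poly_def)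
    moreover have "((1 - x0)\<^sup>2 - x0 * c)\<^sup>2 \<ge> 0" "x0\<^sup>2 * e \<ge> 0" using e by auto
    ultimately have "((1 - x0)\<^sup>2 - x0 * c)\<^sup>2 = 0" "x0\<^sup>2 * e = 0" by linarith+
    then have e0: "e = 0" and c: "c = (1 - x0)\<^sup>2 / x0" using x0_pos by (auto simp: field_simps)
    have P_eq: "P z = ((x0 - z) * (1 / x0 - z))\<^sup>2" for z
    proof -
      have "(1 - z)\<^sup>2 - z * c = (x0 - z) * (1 / x0 - z)"
        unfolding c using x0_pos by (simp add: field_simps power2_eq_square)
      then show ?thesis using \<mu> by (simp add: P_def gf_base_def gf_poly_def e0)
    qed
    have x0_inv: "1 / x0 > 1" using x0r r x0_pos by simp
    then have x0_gap: "1 / x0 - x0 \<noteq> 0" using x0r r by linarith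
    \<comment> \<open>Since \<open>x0 < r\<close>, the series is differentiable at
      \<open>x0\<close>, so its difference quotient times
      \<open>(x0 - z) powr (1 + 2 * \<mu>)\<close> tends to 0, the exponent being positive. By the
      formula this product is \<open>- (K z * (1 / x0 - z) powr (- 2 * \<mu>))\<close>, whose limit
      is nonzero.\<close>
    obtain D where "(\<phi> has_real_derivative D) (at x0)"
      using termdiffs_strong[OF sm, of x0] x0r x0_pos unfolding \<phi>_def by auto
    then have "((\<lambda>z. (\<phi> z - \<phi> x0) / (z - x0)) \<longlongrightarrow> D) (at_left x0)"
      unfolding has_field_derivative_iff by (rule tendsto_within_subset) simp
    moreover have "((\<lambda>z. (x0 - z) powr (1 + 2 * \<mu>)) \<longlongrightarrow> 0) (at_left x0)"
    proof -
      have "((\<lambda>z. x0 - z) \<longlongrightarrow> 0) (at_left x0)" by (auto intro!: tendsto_eq_intros)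
      moreover have "\<forall>\<^sub>F z in at_left x0. 0 \<le> x0 - z"
        using near[OF x0_pos] by eventually_elim auto
      ultimately show ?thesis
        using tendsto_powr'[of "\<lambda>z. x0 - z" 0 "at_left x0" "\<lambda>_. 1 + 2 * \<mu>" "1 + 2 * \<mu>"] assms(1) by simp
    qed
    ultimately have "((\<lambda>z. (\<phi> z - \<phi> x0) / (z - x0) * (x0 - z) powr (1 + 2 * \<mu>)) \<longlongrightarrow> D * 0) (at_left x0)"
      by (rule tendsto_mult)
    moreover have "\<forall>\<^sub>F z in at_left x0. (\<phi> z - \<phi> x0) / (z - x0) * (x0 - z) powr (1 + 2 * \<mu>)
        = - (K z * (1 / x0 - z) powr (- 2 * \<mu>))"
      using near[OF x0_pos]
    proof eventually_elim
      case (elim z)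
      define d where "d = x0 - z"
      define q where "q = 1 / x0 - z"
      have d: "d > 0" using elim by (simp add: d_def)
      have q: "q > 0" unfolding q_def using elim x0_inv x0r(2) r(2) unfolding greaterThanLessThan_iff by linarith
      have "P z powr (- \<mu>) = ((d * q) powr 2) powr (- \<mu>)"
        unfolding P_eq d_def[symmetric] q_def[symmetric] using d q by (subst powr_numeral) auto
      also have "\<dots> = (d * q) powr (- 2 * \<mu>)"
        unfolding powr_powr by simp
      also have "\<dots> = d powr (- 2 * \<mu>) * q powr (- 2 * \<mu>)"
        by (rule powr_mult)
      finally have "\<phi> z = K z * (d powr (- 2 * \<mu>) * q powr (- 2 * \<mu>))"
        using \<phi>_eq[of z x0] elim x0r before by simp
      moreover have "d powr (1 + 2 * \<mu>) = d * d powr (2 * \<mu>)"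
        using d by (simp add: powr_add)
      moreover have "d powr (- 2 * \<mu>) * d powr (2 * \<mu>) = 1"
        using d by (simp flip: powr_add)
      moreover have "z - x0 = - d" by (simp add: d_def)
      ultimately have "(\<phi> z - \<phi> x0) / (z - x0) * d powr (1 + 2 * \<mu>)
          = - (K z * q powr (- 2 * \<mu>) * (d powr (- 2 * \<mu>) * d powr (2 * \<mu>)))"
        using d \<phi>0 by simp
      also have "\<dots> = - (K z * q powr (- 2 * \<mu>))"
        unfolding \<open>d powr (- 2 * \<mu>) * d powr (2 * \<mu>) = 1\<close> by simp
      finally show ?case by (simp only: d_def q_def)
    qed
    ultimately have "((\<lambda>z. - (K z * (1 / x0 - z) powr (- 2 * \<mu>))) \<longlongrightarrow> 0) (at_left x0)"
      by (simp add: tendsto_cong)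
    moreover have "((\<lambda>z. - (K z * (1 / x0 - z) powr (- 2 * \<mu>))) \<longlongrightarrow> - (K x0 * (1 / x0 - x0) powr (- 2 * \<mu>))) (at_left x0)"
      by (intro tendsto_intros K_lim) (use x0_gap x0r r in auto)
    ultimately have "- (K x0 * (1 / x0 - x0) powr (- 2 * \<mu>)) = 0"
      using tendsto_unique[of "at_left x0"] by fastforce
    then show False using K_pos[of x0] x0_gap by simp
  qed
  show ?thesis
  proof (cases "P r = 0")
    case True
    from \<phi>_zero[OF r(1) order_refl no_zero True] have "\<mu> < 0" "\<phi> r = 0" by auto
    moreover have "gf_poly e c r = 0" using True \<open>\<mu> < 0\<close> by (simp add: P_def gf_base_def)
    \<comment> \<open>Here the denominator is \<open>0 powr \<mu> = 0\<close>, and division by zero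
      gives 0, which is the actual value of the sum for \<open>\<mu> < 0\<close>.\<close>
    ultimately show ?thesis by (simp add: \<phi>_def rpow_def)
  next
    case False
    have "((\<lambda>x. K x * P x powr (- \<mu>)) \<longlongrightarrow> K r * P r powr (- \<mu>)) (at_left r)"
      by (intro tendsto_intros K_lim P_lim r) (use False in simp)
    moreover have "\<forall>\<^sub>F x in at_left r. K x * P x powr (- \<mu>) = \<phi> x"
      using near[OF r(1)] by eventually_elim (use \<phi>_eq[of _ r] no_zero in auto)
    ultimately have "(\<phi> \<longlongrightarrow> K r * P r powr (- \<mu>)) (at_left r)" by (simp add: tendsto_cong)
    moreover have "at_left r \<noteq> bot" by simp
    ultimately have "\<phi> r = K r * P r powr (- \<mu>)"
      using tendsto_unique \<phi>_lim[of r] r by blast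
    then show ?thesis
      by (simp add: \<phi>_def K_def P_def gf_base_def rpow_def powr_minus_divide)
  qed
qed

text \<open>As \<open>t\<close> is unbounded, the quartic can vanish in the disc, and for
  \<open>\<mu> \<noteq> 0\<close> a zero between 0 and \<open>r\<close> excludes convergence at
  \<open>r\<close>. Hence the value is asserted for a convergent series, and convergence separately
  for zero-free closed discs or \<open>\<mu> = 0\<close>.\<close>

theorem proposition5p1:
  fixes \<mu> \<beta> r t :: real and b x :: "real ^ 'd"
  assumes "\<mu> > - 1/2" and "\<beta> > - real CARD('d)"
    and "b \<in> cball 0 1" and "(x, t) \<in> solid_cone"
    and "0 < r" and "r < 1"
  shows "(summable (UL_gf_term \<beta> \<mu> b x t r) \<longrightarrow>
            (\<Sum>n. UL_gf_term \<beta> \<mu> b x t r n) =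
              (1 - r) powr (2 * \<mu>) * exp (- (t * r / (1 - r)))
              / ((1 - r) powr (\<beta> + real CARD('d))
                 * rpow (((1 - r)^2 - r * (b \<bullet> x))^2
                         + r^2 * (norm b)^2 * (t^2 - (norm x)^2)) \<mu>))
       \<and> (\<mu> = 0 \<or>
            (\<forall>z::complex. cmod z \<le> r \<longrightarrow>
               ((1 - z)^2 - z * of_real (b \<bullet> x))^2
               + z^2 * of_real ((norm b)^2 * (t^2 - (norm x)^2)) \<noteq> 0) \<longrightarrow>
          summable (UL_gf_term \<beta> \<mu> b x t r))"
proof (intro conjI impI)
  \<comment> \<open>Chosen so that the Laguerre parameter reads \<open>2 * m + s - 1\<close>, as in
    \<open>gf_coeff\<close>.\<close>
  define s where "s = \<beta> + 2 * \<mu> + real CARD('d)"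
  define e where "e = (norm b)^2 * (t^2 - (norm x)^2)"
  define c where "c = b \<bullet> x"
  have "norm x \<le> t" using assms(4) by (simp add: solid_cone_def)
  then have e: "e \<ge> 0" by (simp add: e_def power_mono)
  have terms: "UL_gf_term \<beta> \<mu> b x t r = (\<lambda>n. gf_coeff s \<mu> e c t n * r ^ n)"
    unfolding fun_eq_iff UL_gf_term_eq[OF assms(1)] gf_coeff_def e_def c_def s_def by (simp add: algebra_simps)
  {
    assume "summable (UL_gf_term \<beta> \<mu> b x t r)"
    then have "(\<Sum>n. UL_gf_term \<beta> \<mu> b x t r n)
        = exp (- (s - 4 * \<mu>) * ln (1 - r) - t * r / (1 - r)) / rpow (gf_poly e c r) \<mu>"
      unfolding terms by (intro gf_sum assms e)
    \<comment> \<open>Here \<open>s - 4 * \<mu>\<close> is \<open>\<beta>\<close> plus the dimension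
      minus \<open>2 * \<mu>\<close>, which separates the two powers of
      \<open>1 - r\<close>.\<close>
    also have "- (s - 4 * \<mu>) * ln (1 - r) - t * r / (1 - r)
        = 2 * \<mu> * ln (1 - r) + - (t * r / (1 - r)) - (\<beta> + real CARD('d)) * ln (1 - r)"
      by (simp add: s_def algebra_simps)
    also have "exp \<dots> = (1 - r) powr (2 * \<mu>) * exp (- (t * r / (1 - r))) / (1 - r) powr (\<beta> + real CARD('d))"
      using assms(6) by (simp only: powr_def exp_diff exp_add) simp
    finally show "(\<Sum>n. UL_gf_term \<beta> \<mu> b x t r n) =
              (1 - r) powr (2 * \<mu>) * exp (- (t * r / (1 - r)))
              / ((1 - r) powr (\<beta> + real CARD('d))
                 * rpow (((1 - r)^2 - r * (b \<bullet> x))^2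
                         + r^2 * (norm b)^2 * (t^2 - (norm x)^2)) \<mu>)"
      by (simp add: gf_poly_def e_def c_def mult.assoc)
  next
    assume "\<mu> = 0 \<or> (\<forall>z::complex. cmod z \<le> r \<longrightarrow>
               ((1 - z)^2 - z * of_real (b \<bullet> x))^2
               + z^2 * of_real ((norm b)^2 * (t^2 - (norm x)^2)) \<noteq> 0)"
    then have "gf_base \<mu> e c z \<noteq> 0" if "norm z \<le> r" for z :: complex
      using that by (auto simp: gf_base_def gf_poly_def e_def c_def)
    then show "summable (UL_gf_term \<beta> \<mu> b x t r)"
      unfolding terms by (intro gf_summable assms)
  }
qed

end
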